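(* Let $f,g,h,R$ satisfy the data assumption stated in the context, and let $\Omega\subset\mathbb{R}^N$ be a bounded domain. Let $(u_0,\Omega)$ be an admissible controller--domain pair with $u_0\in C^\infty(\Omega,\mathbb{R}^M)$. Let $\{v_s\}$, $\{u_s\}$, $\{\Omega_s\}$ be the sequences produced by the domain-aware policy iteration described in the context, started from $u_0$ and $\Omega_{-1}=\Omega$, and let $\Omega_\infty:=\bigcap_{s\in\mathbb{N}_0}\Omega_s$. Then: 1. For every $s\in\mathbb{N}_0$ and all $x\in\Omega_s$, $\;v^*(x)\le v_{s+1}(x)\le v_s(x)$. 2. Suppose there exists a domain $\Omega^*\subset\Omega_\infty$ on which an optimal controller $u^*$ exists and which is forward-invariant under $u^*$, and suppose that for every compact $K\subset\Omega^*$ there exist constants $C_{\nabla v,K}>0$ and $C_{H_v,K}>0$ such that $$\max_{x\in K}\|\nabla v_s(x)\|\le C_{\nabla v,K}\quad\text{and}\quad\max_{x\in K}\|H_{v_s}(x)\|_2\le C_{H_v,K}\qquad\text{for all }s\in\mathbb{N}_0,$$ where $H_{v_s}$ is the Hessian of $v_s$. Then: (i) $v^*\in C^1(\Omega^*,\mathbb{R})$ and $\lim_{s\to\infty}\|v_s-v^*\|_{C^1(K,\mathbb{R})}=0$ for every compact $K\subset\Omega^*$; (ii) $\lim_{s\to\infty}\|u_s-u^*\|_{C^0(K,\mathbb{R}^M)}=0$ for every compact $K\subset\Omega^*$.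
   Context: A domain is a non-empty, open and connected subset of $\mathbb{R}^N$; $\|\cdot\|$ is the Euclidean norm, $\|\cdot\|_2$ the spectral norm; $\operatorname{cl}$ denotes closure; $B_\varepsilon(0)$ is the open ball of radius $\varepsilon$ about $0$. $\|\cdot\|_{C^0(K)}$ is the sup norm on $K$ and $\|\cdot\|_{C^1(K)}$ is the norm of uniform convergence on $K$ of the function and its first-order derivatives. Data assumption: $f\in C^\infty(\mathbb{R}^N,\mathbb{R}^N)$, $g\in C^\infty(\mathbb{R}^N,\mathbb{R}^{N\times M})$, $h\in C^\infty(\mathbb{R}^N,\mathbb{R})$, $R\in\mathbb{R}^{M\times M}$ is symmetric positive-definite, $f(0)=0$, and $h$ is a positive-definite function, i.e. $h(0)=0$ and $h(x)>0$ for $x\ne0$. Optimal value function: with $\mathcal{U}_\infty$ the set of measurable essentially bounded $\mathbf{u}:[0,\infty)\to\mathbb{R}^M$, $$v^*(x)=\inf_{\mathbf{u}\in\mathcal{U}_\infty}\int_0^\infty\bigl[h(\mathbf{x}(t))+\langle\mathbf{u}(t),R\,\mathbf{u}(t)\rangle\bigr]\mathrm{d}t\quad\text{s.t.}\quad\dot{\mathbf{x}}(t)=f(\mathbf{x}(t))+g(\mathbf{x}(t))\mathbf{u}(t)\ \text{on }[0,\infty),\ \mathbf{x}(0)=x$$ (solutions in the Carathéodory sense). For a feedback controller $u:\Omega\to\mathbb{R}^M$, $\mathbf{x}_u(t;x)$ denotes the solution of the closed-loop system $\dot{\mathbf{x}}_u(t;x)=f(\mathbf{x}_u(t;x))+g(\mathbf{x}_u(t;x))u(\mathbf{x}_u(t;x))$,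 $\mathbf{x}_u(0;x)=x$. Optimal controller $u^*$ on $\Omega^*$: a continuous feedback $u^*:\Omega^*\to\mathbb{R}^M$ whose closed-loop trajectories attain the infimum, i.e. $\int_0^\infty[h(\mathbf{x}_{u^*}(t;x))+\langle u^*(\mathbf{x}_{u^*}(t;x)),R\,u^*(\mathbf{x}_{u^*}(t;x))\rangle]\mathrm{d}t=v^*(x)$ for every $x\in\Omega^*$. Forward invariance of $\Omega^*$ under $u^*$ means $\mathbf{x}_{u^*}(t;x)\in\Omega^*$ for all $x\in\Omega^*$, $t\ge0$. Admissible controller--domain pair: for a domain $\Omega\subset\mathbb{R}^N$ and $u\in C^0(\Omega,\mathbb{R}^M)$, the pair $(u,\Omega)$ is admissible if (1) $0\in\Omega$; (2) $u(0)=0$; (3) for every $x\in\Omega$, $\mathbf{x}_u(t;x)\in\Omega$ for all $t\ge0$; (4) $\lim_{t\to\infty}\|\mathbf{x}_u(t;x)\|=0$ for all $x\in\Omega$; (5) there exist constants $\varepsilon,C,\nu>0$ with $B_\varepsilon(0)\subset\Omega$ such that $\|\mathbf{x}_u(t;x)\|\le Ce^{-\nu t}\|x\|$ for all $x\in B_\varepsilon(0)$ and $t\ge0$. Domain-aware policy iteration (considered for all $s\in\mathbb{N}_0$, i.e. disregarding the stopping tolerance). Starting from $(u_0,\Omega_{-1})$, for $s=0,1,2,\dots$: (i) let $v_s\in C^1(\Omega_{s-1},\mathbb{R})$ be the (unique) solution of $$\langle f(x)+g(x)u_s(x),\nabla v_s(x)\rangle+h(x)+\langle u_s(x),R\,u_s(x)\rangle=0\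 \text{ for all }x\in\Omega_{s-1},\qquad v_s(0)=0;$$ (ii) set $u_{s+1}(x):=-\tfrac12R^{-1}g(x)^\top\nabla v_s(x)$; (iii) for $\nu\in(0,1)$ put $$c_s^{(\nu)}:=\nu\cdot\sup\Bigl\{c\in\bigl(0,(1-\nu)^{-1}\bigr]\ \Big|\ \operatorname{cl}\bigl(\{x\in\Omega_{s-1}\mid v_s(x)<c\}\bigr)\subset\Omega_{s-1}\Bigr\},$$ $$\Omega_s^{(\nu)}:=\{x\in\Omega_{s-1}\mid v_s(x)<c_s^{(\nu)}\},\qquad \Omega_s:=\bigcup_{\nu\in(0,1)}\Omega_s^{(\nu)}.$$ The controller $u_{s+1}$ is then used on $\Omega_s\subset\Omega_{s-1}$ (restriction). *)

theory Defs
  imports "HOL-Analysis.Analysis"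
begin

section \<open>Differentiability classes and norms\<close>

definition domain :: "'a::real_normed_vector set \<Rightarrow> bool" where
  "domain S \<longleftrightarrow> S \<noteq> {} \<and> open S \<and> connected S"

text \<open>The class C^k on an open set, by recursion over the directional derivatives.\<close>

fun Ck_on :: "nat \<Rightarrow> 'a set \<Rightarrow> ('a::euclidean_space \<Rightarrow> 'b::real_normed_vector) \<Rightarrow> bool" where
  "Ck_on 0 S w \<longleftrightarrow> continuous_on S w"
| "Ck_on (Suc k) S w \<longleftrightarrow>
     (\<forall>x\<in>S. w differentiable (at x)) \<and> (\<forall>e. Ck_on k S (\<lambda>x. frechet_derivative w (at x) e))"

definition smooth_on :: "'a set \<Rightarrow> ('a::euclidean_space \<Rightarrow> 'b::real_normed_vector) \<Rightarrow> bool" where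
  "smooth_on S w \<longleftrightarrow> (\<forall>k. Ck_on k S w)"

text \<open>\<open>grad\<close> and \<open>hessian\<close> are meaningful only where \<open>w\<close>, respectively \<open>grad w\<close>,
  is differentiable.\<close>

definition grad :: "(real^'n \<Rightarrow> real) \<Rightarrow> real^'n \<Rightarrow> real^'n" where
  "grad w x = (THE D. GDERIV w x :> D)"

definition hessian :: "(real^'n \<Rightarrow> real) \<Rightarrow> real^'n \<Rightarrow> real^'n^'n" where
  "hessian w x = jacobian (grad w) (at x)"

definition spectral_norm :: "real^'n^'m \<Rightarrow> real" where
  "spectral_norm A = onorm (\<lambda>x. A *v x)"

text \<open>The norms take values in \<^typ>\<open>ennreal\<close>, so that the supremum over the empty set is 0 and
  an unbounded function has norm \<open>\<infinity>\<close>.\<close>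

definition c0_norm :: "'a set \<Rightarrow> ('a \<Rightarrow> 'b::real_normed_vector) \<Rightarrow> ennreal" where
  "c0_norm K w = (SUP x\<in>K. ennreal (norm (w x)))"

definition c1_norm :: "(real^'n) set \<Rightarrow> (real^'n \<Rightarrow> real) \<Rightarrow> ennreal" where
  "c1_norm K w = c0_norm K w + c0_norm K (grad w)"

section \<open>The optimal control problem\<close>

definition pos_def_matrix :: "real^'m^'m \<Rightarrow> bool" where
  "pos_def_matrix R \<longleftrightarrow> transpose R = R \<and> (\<forall>y. y \<noteq> 0 \<longrightarrow> y \<bullet> (R *v y) > 0)"

definition data_assumption ::
  "(real^'n \<Rightarrow> real^'n) \<Rightarrow> (real^'n \<Rightarrow> real^'m^'n) \<Rightarrow> (real^'n \<Rightarrow> real) \<Rightarrow> real^'m^'m \<Rightarrow> bool" where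
  "data_assumption f g h R \<longleftrightarrow>
     smooth_on UNIV f \<and> smooth_on UNIV g \<and> smooth_on UNIV h \<and> pos_def_matrix R \<and>
     f 0 = 0 \<and> h 0 = 0 \<and> (\<forall>x. x \<noteq> 0 \<longrightarrow> h x > 0)"

text \<open>Under the data assumption the integrand is nonnegative, so the cost is a well-defined
  element of \<open>[0, \<infinity>]\<close>.\<close>

definition cost ::
  "(real^'n \<Rightarrow> real) \<Rightarrow> real^'m^'m \<Rightarrow> (real \<Rightarrow> real^'n) \<Rightarrow> (real \<Rightarrow> real^'m) \<Rightarrow> ereal" where
  "cost h R X U =
     enn2ereal (\<integral>\<^sup>+t\<in>{0..}. ennreal (h (X t) + U t \<bullet> (R *v U t)) \<partial>lebesgue)"

definition input_functions :: "(real \<Rightarrow> real^'m) set" where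
  "input_functions =
     {U. U \<in> borel_measurable (lebesgue_on {0..}) \<and> (\<exists>C. AE t in lebesgue. 0 \<le> t \<longrightarrow> norm (U t) \<le> C)}"

definition abs_continuous_on_interval :: "real \<Rightarrow> real \<Rightarrow> (real \<Rightarrow> 'a::real_normed_vector) \<Rightarrow> bool" where
  "abs_continuous_on_interval l r X \<longleftrightarrow>
     (\<forall>\<epsilon>>0. \<exists>\<delta>>0. \<forall>(k::nat) a b.
        (\<forall>i<k. l \<le> a i \<and> a i \<le> b i \<and> b i \<le> r) \<and>
        (\<forall>i<k. \<forall>j<k. i \<noteq> j \<longrightarrow> {a i<..<b i} \<inter> {a j<..<b j} = {}) \<and>
        (\<Sum>i<k. b i - a i) < \<delta>
        \<longrightarrow> (\<Sum>i<k. norm (X (b i) - X (a i))) < \<epsilon>)"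

definition caratheodory_solution ::
  "(real^'n \<Rightarrow> real^'n) \<Rightarrow> (real^'n \<Rightarrow> real^'m^'n) \<Rightarrow> (real \<Rightarrow> real^'m) \<Rightarrow> real^'n
     \<Rightarrow> (real \<Rightarrow> real^'n) \<Rightarrow> bool" where
  "caratheodory_solution f g U x X \<longleftrightarrow>
     X 0 = x \<and> (\<forall>T>0. abs_continuous_on_interval 0 T X) \<and>
     (AE t in lebesgue. 0 < t \<longrightarrow>
        (X has_vector_derivative f (X t) + g (X t) *v U t) (at t))"

text \<open>Inputs without a solution on all of \<open>[0, \<infinity>)\<close> do not compete; the infimum over the empty set
  is \<open>\<infinity>\<close>.\<close>

definition opt_value ::
  "(real^'n \<Rightarrow> real^'n) \<Rightarrow> (real^'n \<Rightarrow> real^'m^'n) \<Rightarrow> (real^'n \<Rightarrow> real) \<Rightarrow> real^'m^'m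
     \<Rightarrow> real^'n \<Rightarrow> ereal" where
  "opt_value f g h R x =
     Inf {cost h R X U | X U. U \<in> input_functions \<and> caratheodory_solution f g U x X}"

section \<open>Feedback controllers\<close>

text \<open>\<open>\<phi> x t\<close> is the closed-loop state at time \<open>t\<close> started in \<open>x\<close>. A feedback is only defined on
  \<open>\<Omega>\<close>, hence a closed-loop solution for all \<open>t \<ge> 0\<close> has to remain in \<open>\<Omega>\<close>: the predicate contains
  forward invariance of \<open>\<Omega>\<close>. Uniqueness of solutions, which holds for locally Lipschitz feedbacks,
  is not required; for a merely continuous feedback \<open>\<phi> x\<close> is some solution.\<close>

definition closed_loop_flow ::
  "(real^'n \<Rightarrow> real^'n) \<Rightarrow> (real^'n \<Rightarrow> real^'m^'n) \<Rightarrow> (real^'n \<Rightarrow> real^'m) \<Rightarrow> (real^'n) set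
     \<Rightarrow> (real^'n \<Rightarrow> real \<Rightarrow> real^'n) \<Rightarrow> bool" where
  "closed_loop_flow f g u \<Omega> \<phi> \<longleftrightarrow>
     (\<forall>x\<in>\<Omega>. \<phi> x 0 = x \<and>
        (\<forall>t\<ge>0. \<phi> x t \<in> \<Omega> \<and>
           (\<phi> x has_vector_derivative f (\<phi> x t) + g (\<phi> x t) *v u (\<phi> x t)) (at t within {0..})))"

definition admissible ::
  "(real^'n \<Rightarrow> real^'n) \<Rightarrow> (real^'n \<Rightarrow> real^'m^'n) \<Rightarrow> (real^'n \<Rightarrow> real^'m) \<Rightarrow> (real^'n) set \<Rightarrow> bool" where
  "admissible f g u \<Omega> \<longleftrightarrow>
     domain \<Omega> \<and> continuous_on \<Omega> u \<and> 0 \<in> \<Omega> \<and> u 0 = 0 \<and>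
     (\<exists>\<phi>. closed_loop_flow f g u \<Omega> \<phi> \<and>
        (\<forall>x\<in>\<Omega>. ((\<lambda>t. norm (\<phi> x t)) \<longlongrightarrow> 0) at_top) \<and>
        (\<exists>\<epsilon> C \<nu>. \<epsilon> > 0 \<and> C > 0 \<and> \<nu> > 0 \<and> ball 0 \<epsilon> \<subseteq> \<Omega> \<and>
           (\<forall>x\<in>ball 0 \<epsilon>. \<forall>t\<ge>0. norm (\<phi> x t) \<le> C * exp (- \<nu> * t) * norm x)))"

text \<open>An optimal controller on \<open>\<Omega>\<close> under which \<open>\<Omega>\<close> is forward-invariant.\<close>

definition optimal_controller ::
  "(real^'n \<Rightarrow> real^'n) \<Rightarrow> (real^'n \<Rightarrow> real^'m^'n) \<Rightarrow> (real^'n \<Rightarrow> real) \<Rightarrow> real^'m^'m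
     \<Rightarrow> (real^'n \<Rightarrow> real^'m) \<Rightarrow> (real^'n) set \<Rightarrow> bool" where
  "optimal_controller f g h R u \<Omega> \<longleftrightarrow>
     continuous_on \<Omega> u \<and>
     (\<exists>\<phi>. closed_loop_flow f g u \<Omega> \<phi> \<and>
        (\<forall>x\<in>\<Omega>. cost h R (\<phi> x) (\<lambda>t. u (\<phi> x t)) = opt_value f g h R x))"

section \<open>Domain-aware policy iteration\<close>

definition level_bound :: "(real^'n) set \<Rightarrow> (real^'n \<Rightarrow> real) \<Rightarrow> real \<Rightarrow> real" where
  "level_bound D w \<nu> =
     \<nu> * Sup {c \<in> {0<..inverse (1 - \<nu>)}. closure {x\<in>D. w x < c} \<subseteq> D}"

definition next_domain :: "(real^'n) set \<Rightarrow> (real^'n \<Rightarrow> real) \<Rightarrow> (real^'n) set" where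
  "next_domain D w = (\<Union>\<nu>\<in>{0<..<1}. {x\<in>D. w x < level_bound D w \<nu>})"

text \<open>\<open>prev_domain \<Omega> Om s\<close> is the domain with index \<open>s - 1\<close>, the one with index \<open>-1\<close>
  being \<open>\<Omega>\<close>.\<close>

definition prev_domain :: "'a set \<Rightarrow> (nat \<Rightarrow> 'a set) \<Rightarrow> nat \<Rightarrow> 'a set" where
  "prev_domain \<Omega> Om s = (case s of 0 \<Rightarrow> \<Omega> | Suc r \<Rightarrow> Om r)"

definition policy_iteration ::
  "(real^'n \<Rightarrow> real^'n) \<Rightarrow> (real^'n \<Rightarrow> real^'m^'n) \<Rightarrow> (real^'n \<Rightarrow> real) \<Rightarrow> real^'m^'m
     \<Rightarrow> (real^'n \<Rightarrow> real^'m) \<Rightarrow> (real^'n) set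
     \<Rightarrow> (nat \<Rightarrow> real^'n \<Rightarrow> real) \<Rightarrow> (nat \<Rightarrow> real^'n \<Rightarrow> real^'m) \<Rightarrow> (nat \<Rightarrow> (real^'n) set) \<Rightarrow> bool" where
  "policy_iteration f g h R u0 \<Omega> v u Om \<longleftrightarrow>
     (\<forall>x\<in>\<Omega>. u 0 x = u0 x) \<and>
     (\<forall>s. let D = prev_domain \<Omega> Om s in
        Ck_on 1 D (v s) \<and> v s 0 = 0 \<and>
        (\<forall>x\<in>D. (f x + g x *v u s x) \<bullet> grad (v s) x + h x + u s x \<bullet> (R *v u s x) = 0) \<and>
        (\<forall>x\<in>D. u (Suc s) x =
           - (1/2) *\<^sub>R (matrix_inv R *v (transpose (g x) *v grad (v s) x))) \<and>
        Om s = next_domain D (v s))"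

end

(*
  Write F_s = f + g u_s. Completing the square in the GHJB equation shows that v_s is a Lyapunov
  function for F_(s+1), with derivative at most -(h + <u_(s+1), R u_(s+1)>). Hence sublevel sets of
  v_s with compact closure in the current domain are invariant for the improved controller, and its
  trajectories, which exist by Peano's theorem because u_(s+1) is continuous, tend to 0. Integrating
  along them gives v* <= v_(s+1) <= v_s.

  For the limit, monotonicity and the Hessian bounds make v_s and grad v_s converge locally uniformly
  (Dini, and a Landau-type interpolation for the gradients), so the limit V solves the
  Hamilton-Jacobi-Bellman equation with minimizer U = lim u_s. Along an optimal trajectory
  V + (cost so far) has derivative <u* - U, R (u* - U)> >= 0. Its total increase is at most v* - V,
  since the trajectory returns arbitrarily close to 0. As V >= v*, this forces V = v* and u* = U.
*)
theory Submission
  imports Defs "HOL-Complex_Analysis.Great_Picard"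
begin

text \<open>One obstacle is regularity: \<open>v s\<close> is only C^1, so the next closed-loop
  field is only continuous and its solutions may branch. Hence the proof never uses a flow for the
  improved controllers. The induction carries the existence, from every point of the domain, of some
  trajectory that stays there and tends to 0, and each estimate is integrated along one chosen
  trajectory. Another obstacle is the domain update. The supremum of levels is informative only once
  some positive level is known to qualify, and a sublevel set might have pieces far from the origin.
  The old controller settles both: its trajectories must cross a small sphere, so low sublevel sets
  of \<open>v s\<close> lie inside the ball. Boundedness of \<Omega> makes the relevant closures
  compact, which also bounds the feedback inputs and lets them compete in the infimum. In the limit
  argument the domain of the optimal controller need not contain the origin. The terminal value is
  therefore controlled through \<open>v 0\<close>, which dominates the limit and is continuous at
  0.\<close>

section \<open>Peano existence\<close>

text \<open>Euler iterates, regarded as step functions in time: bounding their increments against a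
  constant slope \<open>c\<close> survives a merely pointwise limit and yields the derivative directly, so
  neither interpolation nor uniform convergence is needed.\<close>

lemma peano_bounded:
  fixes F :: "'a::euclidean_space \<Rightarrow> 'a"
  assumes cont: "continuous_on UNIV F" and bd: "\<And>x. norm (F x) \<le> M"
  obtains X where "X 0 = x0"
    "\<And>t. 0 \<le> t \<Longrightarrow> (X has_vector_derivative F (X t)) (at t within {0..})"
proof -
  have M0: "0 \<le> M" using bd[of 0] norm_ge_zero[of "F 0"] by linarith
  define E where "E n k = ((\<lambda>y. y + (1 / real (Suc n)) *\<^sub>R F y) ^^ k) x0" for n k
  have E_Suc: "E n (Suc k) = E n k + (1 / real (Suc n)) *\<^sub>R F (E n k)" for n k
    by (simp add: E_def)
  \<comment> \<open>The slope \<open>c\<close> is left free because two choices are used: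
    \<open>c = 0\<close> bounds the increments by \<open>M\<close>, and \<open>c = F (X a)\<close>
    later produces the derivative at \<open>a\<close>.\<close>
  have est: "norm (E n j - E n i - (real (j - i) / Suc n) *\<^sub>R c) \<le> real (j - i) / Suc n * e"
    if "i \<le> j" "\<And>k. \<lbrakk>i \<le> k; k < j\<rbrakk> \<Longrightarrow> norm (F (E n k) - c) \<le> e" for n i j c e
    using that
  proof (induction j rule: dec_induct)
    case base
    then show ?case by simp
  next
    case (step j)
    have frac: "real (Suc j - i) / Suc n = real (j - i) / Suc n + 1 / real (Suc n)"
      using step.hyps by (simp add: Suc_diff_le add_divide_distrib)
    have "E n (Suc j) - E n i - (real (Suc j - i) / Suc n) *\<^sub>R c
        = (E n j - E n i - (real (j - i) / Suc n) *\<^sub>R c) + (1 / real (Suc n)) *\<^sub>R (F (E n j) - c)"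
      by (simp add: E_Suc frac scaleR_add_left scaleR_diff_right del: of_nat_Suc)
    also have "norm \<dots> \<le> real (j - i) / Suc n * e + (1 / real (Suc n)) * e"
    proof (rule norm_triangle_mono)
      show "norm (E n j - E n i - (real (j - i) / Suc n) *\<^sub>R c) \<le> real (j - i) / Suc n * e"
        using step by auto
      show "norm ((1 / real (Suc n)) *\<^sub>R (F (E n j) - c)) \<le> (1 / real (Suc n)) * e"
        using step.prems[of j] step.hyps by (simp add: divide_right_mono del: of_nat_Suc)
    qed
    also have "\<dots> = real (Suc j - i) / Suc n * e"
      unfolding frac by (simp add: distrib_right)
    finally show ?case .
  qed
  have lip: "norm (E n j - E n i) \<le> real (j - i) / Suc n * M" if "i \<le> j" for n i j
    using est[OF that, of n 0 M] bd by simp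
  define N where "N n t = nat \<lfloor>real (Suc n) * t\<rfloor>" for n t
  define Y where "Y n t = E n (N n t)" for n t
  have N_mono: "N n s \<le> N n t" if "s \<le> t" for n s t
    unfolding N_def using that by (intro nat_mono floor_mono mult_left_mono) auto
  have N_le: "real (N n t) / Suc n \<le> t" and N_ge: "t - 1 / Suc n \<le> real (N n t) / Suc n"
    if "0 \<le> t" for n t
  proof -
    have "real (N n t) = of_int \<lfloor>real (Suc n) * t\<rfloor>"
      using that unfolding N_def by simp
    then have "real (N n t) \<le> t * Suc n" "t * Suc n - 1 \<le> real (N n t)"
      by (simp_all only: mult.commute[of t]) linarith+
    moreover have "t - 1 / Suc n = (t * Suc n - 1) / Suc n"
      by (simp add: diff_divide_distrib del: of_nat_Suc)
    ultimately show "real (N n t) / Suc n \<le> t" "t - 1 / Suc n \<le> real (N n t) / Suc n"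
      by (simp_all add: pos_divide_le_eq divide_right_mono del: of_nat_Suc)
  qed
  have N_diff: "real (N n t - N n s) / Suc n \<le> t - s + 1 / Suc n" if "0 \<le> s" "s \<le> t" for n s t
    using N_le[of t n] N_ge[of s n] N_mono[OF that(2), of n] that by (simp add: of_nat_diff diff_divide_distrib)
  have N_lim: "(\<lambda>n. real (N (r n) t) / Suc (r n)) \<longlonglongrightarrow> t" if "0 \<le> t" "strict_mono r" for t r
  proof (rule tendsto_sandwich)
    show "\<forall>\<^sub>F n in sequentially. t - 1 / Suc (r n) \<le> real (N (r n) t) / Suc (r n)"
      "\<forall>\<^sub>F n in sequentially. real (N (r n) t) / Suc (r n) \<le> t"
      using N_le N_ge that by auto
    have "(\<lambda>n. t - 1 / Suc n) \<longlonglongrightarrow> t - 0"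
      by (intro tendsto_intros LIMSEQ_Suc lim_1_over_n)
    from LIMSEQ_subseq_LIMSEQ[OF this that(2)]
    show "(\<lambda>n. t - 1 / Suc (r n)) \<longlonglongrightarrow> t" by (simp add: o_def)
  qed auto
  have Y_lip: "norm (Y n t - Y n s) \<le> (t - s + 1 / Suc n) * M" if "0 \<le> s" "s \<le> t" for n s t
  proof -
    have "norm (Y n t - Y n s) \<le> real (N n t - N n s) / Suc n * M"
      unfolding Y_def by (rule lip[OF N_mono[OF that(2)]])
    also have "\<dots> \<le> (t - s + 1 / Suc n) * M"
      by (rule mult_right_mono[OF N_diff[OF that] M0])
    finally show ?thesis .
  qed
  have Y0: "Y n 0 = x0" for n by (simp add: Y_def N_def E_def)
  \<comment> \<open>Extraction of a pointwise convergent subsequence asks for one bound valid at all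
    times. The iterates grow at most linearly in \<open>t\<close>, so dividing by
    \<open>1 + t\<close> supplies it.\<close>
  define Z where "Z n t = Y n t /\<^sub>R (1 + t)" for n t
  have Zb: "norm (Z n t) \<le> norm x0 + M" if "t \<in> \<rat> \<inter> {0..}" for n t
  proof -
    have t: "0 \<le> t" using that by auto
    have "norm (Y n t - x0) \<le> real (N n t) / Suc n * M"
      using lip[of 0 "N n t" n] by (simp add: Y_def E_def)
    also have "\<dots> \<le> t * M" by (rule mult_right_mono[OF N_le[OF t] M0])
    finally have "norm (Y n t) \<le> norm x0 + t * M"
      using norm_triangle_sub[of "Y n t" x0] by simp
    also have "\<dots> \<le> (1 + t) * (norm x0 + M)"
      using t M0 by (simp add: algebra_simps)
    finally have "norm (Y n t) / (1 + t) \<le> norm x0 + M"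
      using t by (simp add: pos_divide_le_eq mult.commute)
    then show ?thesis using t by (simp add: Z_def divide_inverse mult.commute)
  qed
  have cnt: "countable (\<rat> \<inter> {0::real..})" by (simp add: countable_rat)
  obtain r where r: "strict_mono (r::nat\<Rightarrow>nat)"
    and Zl: "\<And>t. t \<in> \<rat> \<inter> {0..} \<Longrightarrow> \<exists>l. (\<lambda>n. Z (r n) t) \<longlonglongrightarrow> l"
    by (rule function_convergent_subsequence[of _ Z, OF cnt Zb]) blast+
  have Yl: "\<exists>l. (\<lambda>n. Y (r n) t) \<longlonglongrightarrow> l" if t: "t \<in> \<rat>" "0 \<le> t" for t
  proof -
    obtain l where "(\<lambda>n. Z (r n) t) \<longlonglongrightarrow> l" using Zl[of t] t by blast
    then have "(\<lambda>n. (1 + t) *\<^sub>R Z (r n) t) \<longlonglongrightarrow> (1 + t) *\<^sub>R l" by (intro tendsto_intros)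
    moreover have "(1 + t) *\<^sub>R Z (r n) t = Y (r n) t" for n using t by (simp add: Z_def)
    ultimately show ?thesis by auto
  qed
  have rn: "(\<lambda>n. 1 / real (Suc (r n))) \<longlonglongrightarrow> 0"
    using LIMSEQ_subseq_LIMSEQ[OF LIMSEQ_Suc[OF lim_1_over_n] r] by (simp add: o_def)
  \<comment> \<open>Up to the vanishing mesh width the step functions are equi-Lipschitz, so
    convergence at a rational \<open>q\<close> just after \<open>t\<close> forces the Cauchy
    property at \<open>t\<close>. The error budget is \<open>3/8 + 1/4 + 3/8\<close> of
    \<open>e\<close>.\<close>
  have conv: "convergent (\<lambda>n. Y (r n) t)" if t: "0 \<le> t" for t
  proof (rule Cauchy_convergent, rule metric_CauchyI)
    fix e :: real assume e: "0 < e"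
    define d where "d = e / (4 * (M + 1))"
    have d: "0 < d" "d * M \<le> e / 4" using e M0 by (auto simp: d_def field_simps)
    obtain q where q: "q \<in> \<rat>" "t < q" "q < t + d"
      using Rats_dense_in_real[of t "t + d"] d by auto
    have "Cauchy (\<lambda>n. Y (r n) q)" using Yl[of q] q t LIMSEQ_imp_Cauchy by force
    then obtain n1 where n1: "\<And>m n. m \<ge> n1 \<Longrightarrow> n \<ge> n1 \<Longrightarrow> dist (Y (r m) q) (Y (r n) q) < e / 4"
      using e unfolding Cauchy_def by (meson divide_pos_pos zero_less_numeral)
    have "(\<lambda>n. (d + 1 / real (Suc (r n))) * M) \<longlonglongrightarrow> (d + 0) * M"
      by (intro tendsto_intros rn)
    moreover have "(d + 0) * M < 3 * e / 8" using d e by simp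
    ultimately have "\<forall>\<^sub>F n in sequentially. (d + 1 / real (Suc (r n))) * M < 3 * e / 8"
      by (rule order_tendstoD(2))
    then obtain n2 where n2: "\<And>n. n \<ge> n2 \<Longrightarrow> (d + 1 / real (Suc (r n))) * M < 3 * e / 8"
      unfolding eventually_sequentially by blast
    have cl: "dist (Y (r n) t) (Y (r n) q) < 3 * e / 8" if "n \<ge> n2" for n
    proof -
      have "norm (Y (r n) q - Y (r n) t) \<le> (q - t + 1 / Suc (r n)) * M"
        using Y_lip q t by simp
      also have "\<dots> \<le> (d + 1 / real (Suc (r n))) * M"
        using q by (intro mult_right_mono[OF _ M0]) auto
      finally show ?thesis
        using n2[OF that] by (metis dist_norm dist_commute le_less_trans)
    qed
    show "\<exists>K. \<forall>m\<ge>K. \<forall>n\<ge>K. dist (Y (r m) t) (Y (r n) t) < e"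
    proof (intro exI allI impI)
      fix m n assume "max n1 n2 \<le> m" "max n1 n2 \<le> n"
      then have "dist (Y (r m) t) (Y (r m) q) < 3 * e / 8" "dist (Y (r n) t) (Y (r n) q) < 3 * e / 8"
        "dist (Y (r m) q) (Y (r n) q) < e / 4" using cl n1 by auto
      then show "dist (Y (r m) t) (Y (r n) t) < e"
        using dist_triangle[of "Y (r m) t" "Y (r n) t" "Y (r m) q"]
          dist_triangle[of "Y (r m) q" "Y (r n) t" "Y (r n) q"] by (simp add: dist_commute)
    qed
  qed
  define X where "X t = lim (\<lambda>n. Y (r n) t)" for t
  have XL: "(\<lambda>n. Y (r n) t) \<longlonglongrightarrow> X t" if "0 \<le> t" for t
    using conv[OF that] by (simp add: X_def convergent_LIMSEQ_iff)
  have X0: "X 0 = x0" by (simp add: X_def Y0)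
  \<comment> \<open>For large \<open>n\<close> every Euler iterate between times \<open>s\<close>
    and \<open>t\<close> is within \<delta> of \<open>X a\<close>, so \<open>est\<close> applies
    with \<open>c = F (X a)\<close>, and the inequality passes to the limit. Taking
    \<open>a = s\<close> and \<open>a = t\<close> gives the right and the left difference
    quotients.\<close>
  have main: "norm (X t - X s - (t - s) *\<^sub>R F (X a)) \<le> (t - s) * e"
    if st: "0 \<le> s" "s \<le> t" "s \<le> a" "a \<le> t" and e: "0 < e"
      and dl: "(t - s) * M < \<delta>" "\<And>y. norm (y - X a) < \<delta> \<Longrightarrow> norm (F y - F (X a)) \<le> e"
    for s t a e \<delta>
  proof (rule tendsto_le[OF trivial_limit_sequentially])
    let ?\<tau> = "\<lambda>n t. real (N (r n) t) / Suc (r n)"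
    show "(\<lambda>n. (?\<tau> n t - ?\<tau> n s) * e) \<longlonglongrightarrow> (t - s) * e"
      using st r by (intro tendsto_intros N_lim) auto
    show "(\<lambda>n. norm (Y (r n) t - Y (r n) s - (?\<tau> n t - ?\<tau> n s) *\<^sub>R F (X a)))
        \<longlonglongrightarrow> norm (X t - X s - (t - s) *\<^sub>R F (X a))"
      using st r by (intro tendsto_intros N_lim XL) auto
    have "(\<lambda>n. (t - s + 1 / Suc (r n)) * M + norm (Y (r n) a - X a)) \<longlonglongrightarrow> (t - s + 0) * M + norm (X a - X a)"
      using st by (intro tendsto_intros rn XL) auto
    then have "\<forall>\<^sub>F n in sequentially. (t - s + 1 / Suc (r n)) * M + norm (Y (r n) a - X a) < \<delta>"
      by (rule order_tendstoD(2)) (use dl in simp)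
    then show "\<forall>\<^sub>F n in sequentially. norm (Y (r n) t - Y (r n) s - (?\<tau> n t - ?\<tau> n s) *\<^sub>R F (X a))
        \<le> (?\<tau> n t - ?\<tau> n s) * e"
    proof eventually_elim
      case (elim n)
      have close: "norm (F (E (r n) k) - F (X a)) \<le> e" if k: "N (r n) s \<le> k" "k < N (r n) t" for k
      proof (rule dl(2))
        have b: "real (N (r n) t - N (r n) s) / Suc (r n) * M \<le> (t - s + 1 / Suc (r n)) * M"
          by (rule mult_right_mono[OF N_diff[OF st(1,2)] M0])
        have "norm (E (r n) k - Y (r n) a) \<le> real (N (r n) t - N (r n) s) / Suc (r n) * M"
        proof (cases "k \<le> N (r n) a")
          case True
          have "norm (Y (r n) a - E (r n) k) \<le> real (N (r n) a - k) / Suc (r n) * M"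
            unfolding Y_def by (rule lip[OF True])
          also have "\<dots> \<le> real (N (r n) t - N (r n) s) / Suc (r n) * M"
            using N_mono[OF st(4), of "r n"] k
            by (intro mult_right_mono[OF _ M0] divide_right_mono) auto
          finally show ?thesis by (simp add: norm_minus_commute)
        next
          case False
          have "norm (E (r n) k - Y (r n) a) \<le> real (k - N (r n) a) / Suc (r n) * M"
            unfolding Y_def by (rule lip) (use False in simp)
          also have "\<dots> \<le> real (N (r n) t - N (r n) s) / Suc (r n) * M"
            using N_mono[OF st(3), of "r n"] k
            by (intro mult_right_mono[OF _ M0] divide_right_mono) auto
          finally show ?thesis .
        qed
        then show "norm (E (r n) k - X a) < \<delta>"
          using b elim norm_triangle_ineq[of "E (r n) k - Y (r n) a" "Y (r n) a - X a"] by simp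
      qed
      have "?\<tau> n t - ?\<tau> n s = real (N (r n) t - N (r n) s) / Suc (r n)"
        using N_mono[OF st(2), of "r n"] by (simp add: of_nat_diff diff_divide_distrib)
      with est[OF N_mono[OF st(2)] close] show ?case
        by (simp add: Y_def)
    qed
  qed
  show ?thesis
  proof (rule that[of X, OF X0])
    fix a :: real assume a: "0 \<le> a"
    show "(X has_vector_derivative F (X a)) (at a within {0..})"
      unfolding has_vector_derivative_def has_derivative_within_alt
    proof (intro conjI allI impI)
      fix e :: real assume e: "0 < e"
      obtain \<delta> where \<delta>: "\<delta> > 0" "\<And>y. norm (y - X a) < \<delta> \<Longrightarrow> norm (F y - F (X a)) < e"
        using cont e unfolding continuous_on_iff by (metis UNIV_I dist_norm)
      define d where "d = \<delta> / (M + 1)"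
      have d: "0 < d" "d * M < \<delta>" using \<delta> M0 by (auto simp: d_def field_simps)
      show "\<exists>d>0. \<forall>y\<in>{0..}. norm (y - a) < d \<longrightarrow>
          norm (X y - X a - (y - a) *\<^sub>R F (X a)) \<le> e * norm (y - a)"
      proof (intro exI[of _ d] conjI ballI impI d)
        fix y :: real assume y: "y \<in> {0..}" "norm (y - a) < d"
        have "\<bar>y - a\<bar> * M \<le> d * M" using y by (intro mult_right_mono M0) auto
        with d have yM: "\<bar>y - a\<bar> * M < \<delta>" by linarith
        show "norm (X y - X a - (y - a) *\<^sub>R F (X a)) \<le> e * norm (y - a)"
        proof (cases "a \<le> y")
          case True
          with main[of a y a e \<delta>] a e yM \<delta>(2) show ?thesis by (simp add: less_imp_le mult.commute)
        next
          case False
          have "norm (X a - X y - (a - y) *\<^sub>R F (X a)) \<le> (a - y) * e"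
            using main[of y a a e \<delta>] y False e yM \<delta>(2) by (simp add: less_imp_le)
          moreover have "X a - X y - (a - y) *\<^sub>R F (X a) = - (X y - X a - (y - a) *\<^sub>R F (X a))"
            by (simp add: algebra_simps)
          ultimately show ?thesis using False by (simp only: norm_minus_cancel) (simp add: mult.commute)
        qed
      qed
    qed (rule bounded_linear_scaleR_left)
  qed
qed

section \<open>Lyapunov functions along trajectories\<close>

text \<open>A relation between a field and a curve rather than a flow, since a continuous field may
  have several solutions from one point. The one-sided filter matters only at time 0.\<close>

definition trajectory_in :: "'a::real_normed_vector set \<Rightarrow> ('a \<Rightarrow> 'a) \<Rightarrow> (real \<Rightarrow> 'a) \<Rightarrow> bool" where
  "trajectory_in D F X \<longleftrightarrow>
     (\<forall>t\<ge>0. X t \<in> D \<and> (X has_vector_derivative F (X t)) (at t within {0..}))"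

lemma trajectory_inD:
  assumes "trajectory_in D F X" "0 \<le> t"
  shows "X t \<in> D" "(X has_vector_derivative F (X t)) (at t within {0..})"
  using assms by (auto simp: trajectory_in_def)

lemma trajectory_in_mono: "trajectory_in W F X \<Longrightarrow> W \<subseteq> D \<Longrightarrow> trajectory_in D F X"
  by (auto simp: trajectory_in_def)

lemma trajectory_in_continuous: "trajectory_in D F X \<Longrightarrow> continuous_on {0..} X"
  unfolding continuous_on_eq_continuous_within
  by (auto simp: trajectory_in_def intro: has_vector_derivative_continuous)

lemma has_real_derivative_along:
  fixes X :: "real \<Rightarrow> 'a::euclidean_space"
  assumes "(X has_vector_derivative p) (at t within S)" and "GDERIV w (X t) :> q"
  shows "((\<lambda>t. w (X t)) has_real_derivative q \<bullet> p) (at t within S)"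
proof -
  have "((\<lambda>t. w (X t)) has_derivative (\<lambda>h. (h *\<^sub>R p) \<bullet> q)) (at t within S)"
    using has_derivative_compose[OF assms(1)[unfolded has_vector_derivative_def]
        assms(2)[unfolded gderiv_def]] by simp
  then show ?thesis
    unfolding has_field_derivative_def
    by (rule has_derivative_eq_rhs) (auto simp: inner_commute)
qed

lemma GDERIV_continuous_on: "(\<And>y. y \<in> D \<Longrightarrow> GDERIV w y :> G y) \<Longrightarrow> continuous_on D w"
  unfolding gderiv_def
  by (meson continuous_at_imp_continuous_on has_derivative_continuous)

lemma real_derivative_nonpos_imp_le:
  fixes V :: "real \<Rightarrow> real"
  assumes ab: "a \<le> b"
    and der: "\<And>t. \<lbrakk>a \<le> t; t \<le> b\<rbrakk> \<Longrightarrow> (V has_real_derivative V' t) (at t within {a..})"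
    and le: "\<And>t. \<lbrakk>a \<le> t; t \<le> b\<rbrakk> \<Longrightarrow> V' t \<le> 0"
  shows "V b \<le> V a"
proof -
  have "\<exists>t\<in>{a..b}. V b - V a = V' t * (b - a)"
  proof (rule mvt_very_simple[OF ab])
    fix t assume "a \<le> t" "t \<le> b"
    then show "(V has_derivative (*) (V' t)) (at t within {a..b})"
      using der unfolding has_field_derivative_def
      by (meson Icc_subset_Ici_iff has_derivative_subset order_refl)
  qed
  then obtain t where "t \<in> {a..b}" "V b - V a = V' t * (b - a)" by blast
  then show ?thesis using le[of t] ab mult_nonpos_nonneg[of "V' t" "b - a"] by auto
qed

lemma trajectory_descent:
  fixes X :: "real \<Rightarrow> 'a::euclidean_space"
  assumes X: "trajectory_in D F X"
    and G: "\<And>y. y \<in> D \<Longrightarrow> GDERIV w y :> G y"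
    and desc: "\<And>y. y \<in> D \<Longrightarrow> G y \<bullet> F y \<le> 0"
    and st: "0 \<le> s" "s \<le> t"
  shows "w (X t) \<le> w (X s)"
proof (rule real_derivative_nonpos_imp_le[OF st(2), of "\<lambda>t. w (X t)" "\<lambda>t. G (X t) \<bullet> F (X t)"])
  fix r assume r: "s \<le> r" "r \<le> t"
  then have r0: "0 \<le> r" using st by simp
  have "((\<lambda>t. w (X t)) has_real_derivative G (X r) \<bullet> F (X r)) (at r within {0..})"
    by (intro has_real_derivative_along trajectory_inD[OF X r0] G)
  then show "((\<lambda>t. w (X t)) has_real_derivative G (X r) \<bullet> F (X r)) (at r within {s..})"
    by (rule has_field_derivative_subset) (use st in auto)
  show "G (X r) \<bullet> F (X r) \<le> 0" by (intro desc trajectory_inD[OF X r0])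
qed

text \<open>Peano's theorem is available for bounded continuous fields on the whole space, so
  \<open>F\<close> is extended from the compact closure by Tietze. Up to a first exit time the
  solution stays in that closure, where the extension is still \<open>F\<close> and \<open>w\<close>
  does not increase. The exit point lies in \<open>D\<close> because the closure does, so leaving
  would require \<open>w\<close> to reach \<open>c\<close>, although it started below.\<close>

lemma sublevel_trajectory_exists:
  fixes F :: "'a::euclidean_space \<Rightarrow> 'a"
  assumes D: "open D" "bounded D" and F: "continuous_on D F"
    and G: "\<And>y. y \<in> D \<Longrightarrow> GDERIV w y :> G y"
    and desc: "\<And>y. y \<in> D \<Longrightarrow> G y \<bullet> F y \<le> 0"
    and clos: "closure {y \<in> D. w y < c} \<subseteq> D"
    and x: "x \<in> D" "w x < c"
  obtains X where "X 0 = x" "trajectory_in {y \<in> D. w y < c} F X"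
proof -
  define W where "W = {y \<in> D. w y < c}"
  have K: "compact (closure W)" "closure W \<subseteq> D"
    using D clos bounded_subset[of D W] by (auto simp: compact_eq_bounded_closed W_def)
  have opW: "open W"
  proof -
    have "W = D \<inter> w -` {..<c}" by (auto simp: W_def)
    then show ?thesis
      using continuous_open_preimage[OF GDERIV_continuous_on[OF G] D(1), of "{..<c}"] by simp
  qed
  have FK: "continuous_on (closure W) F" using F K(2) by (rule continuous_on_subset)
  then have "bounded (F ` closure W)" using K(1) compact_continuous_image compact_imp_bounded by blast
  then obtain M where M: "0 < M" "\<And>y. y \<in> closure W \<Longrightarrow> norm (F y) \<le> M"
    unfolding bounded_pos by blast
  obtain H where H: "continuous_on UNIV H" "\<And>y. y \<in> closure W \<Longrightarrow> H y = F y"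
    "\<And>y. norm (H y) \<le> M"
    by (rule Tietze[of "closure W" F UNIV M]) (use FK M in \<open>auto simp: less_imp_le\<close>)
  obtain X where X: "X 0 = x"
      "\<And>t. 0 \<le> t \<Longrightarrow> (X has_vector_derivative H (X t)) (at t within {0..})"
    using peano_bounded[OF H(1) H(3)] by blast
  have contX: "continuous_on {0..} X"
    unfolding continuous_on_eq_continuous_within
    using X(2) by (auto intro: has_vector_derivative_continuous)
  have inW: "X t \<in> W" if t: "0 \<le> t" for t
  proof (rule ccontr)
    assume nt: "X t \<notin> W"
    \<comment> \<open>The set of times outside \<open>W\<close>; it is closed because
      \<open>W\<close> is open, so the first exit time belongs to it.\<close>
    define A where "A = {0..} \<inter> X -` (- W)"
    have clA: "closed A" unfolding A_def
      using opW by (intro continuous_closed_preimage[OF contX]) auto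
    have neA: "A \<noteq> {}" and bdA: "bdd_below A" using t nt by (auto simp: A_def intro: bdd_belowI[of _ 0])
    define \<tau> where "\<tau> = Inf A"
    have \<tau>A: "\<tau> \<in> A" unfolding \<tau>_def by (rule closed_contains_Inf[OF neA bdA clA])
    have before: "X s \<in> W" if "0 \<le> s" "s < \<tau>" for s
      using cInf_lower[OF _ bdA, of s] that by (force simp: A_def \<tau>_def)
    have "\<tau> \<noteq> 0" using \<tau>A x X(1) by (auto simp: A_def W_def)
    with \<tau>A have \<tau>0: "0 < \<tau>" by (auto simp: A_def)
    have cl: "X s \<in> closure W" if s: "s \<in> {0..\<tau>}" for s
    proof (rule image_closure_subset[of "{0..<\<tau>}" X "closure W", THEN subsetD])
      show "continuous_on (closure {0..<\<tau>}) X"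
        using \<tau>0 by (auto intro: continuous_on_subset[OF contX])
      show "X ` {0..<\<tau>} \<subseteq> closure W" using before closure_subset[of W] by auto
      show "X s \<in> X ` closure {0..<\<tau>}" using s \<tau>0 by auto
    qed auto
    have "w (X \<tau>) \<le> w (X 0)"
    proof (rule real_derivative_nonpos_imp_le[of 0 \<tau> "\<lambda>t. w (X t)" "\<lambda>t. G (X t) \<bullet> F (X t)"])
      fix r assume r: "0 \<le> r" "r \<le> \<tau>"
      have "X r \<in> closure W" using cl r by auto
      then have D: "X r \<in> D" "H (X r) = F (X r)" using K H by auto
      show "((\<lambda>t. w (X t)) has_real_derivative G (X r) \<bullet> F (X r)) (at r within {0..})"
        using has_real_derivative_along[OF X(2)[OF r(1)] G[OF D(1)]] D by simp
      show "G (X r) \<bullet> F (X r) \<le> 0" by (rule desc[OF D(1)])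
    qed (use \<tau>0 in simp)
    moreover have "X \<tau> \<in> D" using cl[of \<tau>] \<tau>0 K by auto
    ultimately show False using \<tau>A X x by (auto simp: A_def W_def)
  qed
  show ?thesis
  proof (rule that[of X, OF X(1)])
    show "trajectory_in {y \<in> D. w y < c} F X"
      unfolding trajectory_in_def W_def[symmetric]
      using X(2) inW H(2) closure_subset[of W] by (metis subsetD)
  qed
qed

text \<open>If \<open>w\<close> stayed above some \<mu> > 0 along \<open>X\<close>, the trajectory
  would live in a compact set avoiding 0, on which \<open>h\<close> has a positive minimum, and
  \<open>w\<close> would decrease at least linearly and become nonpositive. So \<open>w\<close> gets
  arbitrarily small, stays small by monotonicity, and by compactness small values of
  \<open>w\<close> force small norms.\<close>

lemma lyapunov_trajectory_tendsto_0:
  fixes X :: "real \<Rightarrow> 'a::euclidean_space"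
  assumes X: "trajectory_in W F X"
    and K: "compact (closure W)" "closure W \<subseteq> D"
    and G: "\<And>y. y \<in> D \<Longrightarrow> GDERIV w y :> G y"
    and w: "w 0 = 0" "\<And>y. y \<in> D \<Longrightarrow> y \<noteq> 0 \<Longrightarrow> 0 < w y"
    and desc: "\<And>y. y \<in> D \<Longrightarrow> G y \<bullet> F y \<le> - h y"
    and h: "continuous_on D h" "h 0 = 0" "\<And>y. y \<noteq> 0 \<Longrightarrow> 0 < h y"
  shows "(X \<longlongrightarrow> 0) at_top"
proof -
  have WD: "W \<subseteq> D" using K closure_subset by blast
  have XD: "trajectory_in D F X" by (rule trajectory_in_mono[OF X WD])
  have h0: "0 \<le> h y" for y using h(2) h(3)[of y] by (cases "y = 0") auto
  have desc0: "G y \<bullet> F y \<le> 0" if "y \<in> D" for y using desc[OF that] h0[of y] by linarith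
  have wK: "continuous_on (closure W) w"
    by (rule continuous_on_subset[OF GDERIV_continuous_on K(2)]) (rule G)
  have Xcl: "X t \<in> closure W" if "0 \<le> t" for t
    using trajectory_inD[OF X that] closure_subset by blast
  have below: "\<exists>T\<ge>0. w (X T) < \<mu>" if \<mu>: "0 < \<mu>" for \<mu>
  proof (rule ccontr)
    assume "\<not> (\<exists>T\<ge>0. w (X T) < \<mu>)"
    then have ge: "\<And>t. 0 \<le> t \<Longrightarrow> \<mu> \<le> w (X t)" by force
    define C where "C = closure W \<inter> w -` {\<mu>..}"
    have C: "compact C" unfolding C_def compact_eq_bounded_closed
      using K(1) by (auto intro!: continuous_closed_preimage[OF wK] bounded_subset[of "closure W"]
          simp: compact_eq_bounded_closed)
    have XC: "X t \<in> C" if "0 \<le> t" for t using Xcl[OF that] ge[OF that] by (simp add: C_def)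
    have CD: "C \<subseteq> D" using K by (auto simp: C_def)
    obtain z where z: "z \<in> C" "\<And>y. y \<in> C \<Longrightarrow> h z \<le> h y"
      using continuous_attains_inf[OF C _ continuous_on_subset[OF h(1) CD]] XC[of 0] by auto
    have "z \<noteq> 0" using z(1) \<mu> w(1) by (auto simp: C_def)
    then have m: "0 < h z" by (rule h(3))
    \<comment> \<open>The time at which decay at rate \<open>h z\<close> has consumed all of
      \<open>w (X 0)\<close>.\<close>
    define T where "T = w (X 0) / h z"
    have T: "0 \<le> T" using m ge[of 0] \<mu> by (simp add: T_def)
    have "w (X T) + h z * T \<le> w (X 0) + h z * 0"
    proof (rule real_derivative_nonpos_imp_le[OF T, of "\<lambda>t. w (X t) + h z * t"])
      fix r :: real assume r: "0 \<le> r"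
      show "((\<lambda>t. w (X t) + h z * t) has_real_derivative G (X r) \<bullet> F (X r) + h z) (at r within {0..})"
        by (auto intro!: derivative_eq_intros has_real_derivative_along trajectory_inD[OF XD r] G)
      show "G (X r) \<bullet> F (X r) + h z \<le> 0"
        using desc[OF trajectory_inD(1)[OF XD r]] z(2)[OF XC[OF r]] by linarith
    qed
    then have "w (X T) \<le> 0" using m by (simp add: T_def)
    then show False using ge[OF T] \<mu> by linarith
  qed
  show ?thesis
  proof (rule tendstoI)
    fix e :: real assume e: "0 < e"
    have "\<exists>\<mu>>0. \<forall>y\<in>closure W. w y < \<mu> \<longrightarrow> norm y < e"
    proof (cases "closure W - ball 0 e = {}")
      case True
      then show ?thesis by (auto intro!: exI[of _ 1])
    next
      case False
      have "compact (closure W - ball 0 e)" using K(1) compact_diff open_ball by blast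
      then obtain z where z: "z \<in> closure W - ball 0 e" "\<And>y. y \<in> closure W - ball 0 e \<Longrightarrow> w z \<le> w y"
        using continuous_attains_inf[OF _ False continuous_on_subset[OF wK]] by auto
      have "z \<in> D" "z \<noteq> 0" using z(1) e K(2) by auto
      then have "0 < w z" by (rule w(2))
      then show ?thesis using z(2) by (intro exI[of _ "w z"]) force
    qed
    then obtain \<mu> where \<mu>: "0 < \<mu>" "\<And>y. y \<in> closure W \<Longrightarrow> w y < \<mu> \<Longrightarrow> norm y < e" by blast
    obtain T where T: "0 \<le> T" "w (X T) < \<mu>" using below[OF \<mu>(1)] by blast
    show "\<forall>\<^sub>F t::real in at_top. dist (X t) 0 < e"
      unfolding eventually_at_top_linorder
    proof (intro exI allI impI)
      fix t assume t: "T \<le> t"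
      have "w (X t) \<le> w (X T)" by (rule trajectory_descent[OF XD G desc0 T(1) t])
      then show "dist (X t) 0 < e" using \<mu>(2)[OF Xcl[of t]] T t by simp
    qed
  qed
qed

lemma value_tendsto_0:
  fixes X :: "real \<Rightarrow> 'a::euclidean_space"
  assumes "open D" "0 \<in> D" "\<And>y. y \<in> D \<Longrightarrow> GDERIV w y :> G y" "w 0 = 0" "(X \<longlongrightarrow> 0) A"
  shows "((\<lambda>t. w (X t)) \<longlongrightarrow> 0) A"
proof -
  have "isCont w 0" using assms GDERIV_continuous_on continuous_on_eq_continuous_at by metis
  from isCont_tendsto_compose[OF this assms(5)] show ?thesis using assms by simp
qed

text \<open>Along \<open>X\<close> the function \<open>w\<close> decreases to its limit 0, hence is
  nonnegative there; since \<open>h x > 0\<close>, it drops strictly just after time 0, so its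
  initial value is positive.\<close>

lemma value_pos:
  fixes w :: "'a::euclidean_space \<Rightarrow> real"
  assumes D: "open D" "0 \<in> D"
    and X: "trajectory_in D F X" "(X \<longlongrightarrow> 0) at_top" "X 0 = x"
    and G: "\<And>y. y \<in> D \<Longrightarrow> GDERIV w y :> G y" and w: "w 0 = 0"
    and desc: "\<And>y. y \<in> D \<Longrightarrow> G y \<bullet> F y \<le> - h y"
    and h: "h 0 = 0" "\<And>y. y \<noteq> 0 \<Longrightarrow> 0 < h y" and x: "x \<noteq> 0"
  shows "0 < w x"
proof -
  have h0: "0 \<le> h y" for y using h(1) h(2)[of y] by (cases "y = 0") auto
  have desc0: "G y \<bullet> F y \<le> 0" if "y \<in> D" for y using desc[OF that] h0[of y] by linarith
  have lim: "((\<lambda>t. w (X t)) \<longlongrightarrow> 0) at_top" by (rule value_tendsto_0[OF D G w X(2)])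
  have nn: "0 \<le> w (X t)" if t: "0 \<le> t" for t
  proof (rule tendsto_upperbound[OF lim])
    show "\<forall>\<^sub>F r::real in at_top. w (X r) \<le> w (X t)"
      unfolding eventually_at_top_linorder
      using trajectory_descent[OF X(1) G desc0 t] by blast
  qed simp
  have xD: "x \<in> D" using trajectory_inD(1)[OF X(1), of 0] X(3) by simp
  have "((\<lambda>t. w (X t)) has_real_derivative G x \<bullet> F x) (at 0 within {0..})"
    using has_real_derivative_along[OF trajectory_inD(2)[OF X(1), of 0] G[of "X 0"]] X(3) xD by simp
  moreover have "G x \<bullet> F x < 0" using desc[OF xD] h(2)[OF x] by linarith
  ultimately have "\<exists>d>0. \<forall>r>0. 0 + r \<in> {0..} \<longrightarrow> r < d \<longrightarrow> w (X (0 + r)) < w (X 0)"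
    by (rule has_real_derivative_neg_dec_right)
  then obtain d where d: "d > 0" "\<forall>r>0. 0 + r \<in> {0..} \<longrightarrow> r < d \<longrightarrow> w (X (0 + r)) < w (X 0)"
    by blast
  have "w (X (d/2)) < w x" using d(2)[rule_format, of "d/2"] d(1) X(3) by simp
  with nn[of "d/2"] d(1) show ?thesis by simp
qed

section \<open>Compact sublevel sets and the domain update\<close>

text \<open>The level is the minimum of \<open>w\<close> over a small sphere. A point on or outside
  the sphere has a trajectory tending to 0, which meets the sphere while \<open>w\<close> does not
  increase, so its value is at least that minimum. This excludes low sublevel components far from
  the origin, where the sphere alone would give no information.\<close>

lemma compact_sublevel_exists:
  fixes w :: "'a::euclidean_space \<Rightarrow> real"
  assumes D: "open D" "0 \<in> D"
    and traj: "\<And>x. x \<in> D \<Longrightarrow> \<exists>X. X 0 = x \<and> trajectory_in D F X \<and> (X \<longlongrightarrow> 0) at_top"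
    and G: "\<And>y. y \<in> D \<Longrightarrow> GDERIV w y :> G y"
    and w: "\<And>y. y \<in> D \<Longrightarrow> y \<noteq> 0 \<Longrightarrow> 0 < w y"
    and desc: "\<And>y. y \<in> D \<Longrightarrow> G y \<bullet> F y \<le> 0"
  obtains m where "0 < m" "closure {y \<in> D. w y < m} \<subseteq> D"
proof -
  obtain r where r: "0 < r" "cball 0 r \<subseteq> D" using D open_contains_cball by blast
  have sp: "compact (sphere (0::'a) r)" "sphere (0::'a) r \<noteq> {}" using r by auto
  have sD: "sphere 0 r \<subseteq> D" using r(2) sphere_cball by blast
  obtain z where z: "z \<in> sphere 0 r" "\<And>y. y \<in> sphere 0 r \<Longrightarrow> w z \<le> w y"
    using continuous_attains_inf[OF sp continuous_on_subset[OF GDERIV_continuous_on sD]] G by blast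
  have m: "0 < w z" using w[of z] z(1) sD r(1) by auto
  have "norm y < r" if y: "y \<in> D" "w y < w z" for y
  proof (rule ccontr)
    assume n: "\<not> norm y < r"
    obtain X where X: "X 0 = y" "trajectory_in D F X" "(X \<longlongrightarrow> 0) at_top" using traj[OF y(1)] by blast
    have "\<forall>\<^sub>F t::real in at_top. norm (X t) < r"
      using tendstoD[OF X(3) r(1)] by simp
    then obtain T where T: "0 \<le> T" "norm (X T) < r"
      unfolding eventually_at_top_linorder by (metis max.cobounded1 max.cobounded2)
    have "\<exists>t. 0 \<le> t \<and> t \<le> T \<and> norm (X t) = r"
    proof (rule IVT2')
      show "continuous_on {0..T} (\<lambda>t. norm (X t))"
        using continuous_on_subset[OF trajectory_in_continuous[OF X(2)], of "{0..T}"]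
        by (intro continuous_on_norm) auto
    qed (use T n X(1) in auto)
    then obtain t where t: "0 \<le> t" "norm (X t) = r" by blast
    have "w (X t) \<le> w (X 0)" by (rule trajectory_descent[OF X(2) G desc order_refl t(1)])
    moreover have "w z \<le> w (X t)" using z(2) t by simp
    ultimately show False using X(1) y(2) by simp
  qed
  then have "{y \<in> D. w y < w z} \<subseteq> cball 0 r" by (auto simp: less_imp_le)
  then have "closure {y \<in> D. w y < w z} \<subseteq> cball 0 r" by (rule closure_minimal) simp
  then show ?thesis using that m r(2) by blast
qed

text \<open>The factor \<nu> < 1 keeps the level strictly below the supremum, so a larger level with
  closure inside \<open>D\<close> exists and its closure can be inherited. The witness
  \<open>m\<close>, cut off at the cap \<open>inverse (1 - \<nu>)\<close>, makes the set of levels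
  nonempty and its supremum positive; the cap keeps the supremum finite.\<close>

lemma next_domain_sublevel:
  assumes ex: "0 < m" "closure {y \<in> D. w y < m} \<subseteq> D" and x: "x \<in> next_domain D w"
  obtains c where "x \<in> D" "w x < c" "closure {y \<in> D. w y < c} \<subseteq> D"
    "{y \<in> D. w y < c} \<subseteq> next_domain D w"
proof -
  obtain \<nu> where \<nu>: "0 < \<nu>" "\<nu> < 1" "x \<in> D" "w x < level_bound D w \<nu>"
    using x by (auto simp: next_domain_def)
  define A where "A = {c \<in> {0<..inverse (1 - \<nu>)}. closure {x\<in>D. w x < c} \<subseteq> D}"
  have "closure {y \<in> D. w y < min m (inverse (1 - \<nu>))} \<subseteq> closure {y \<in> D. w y < m}"
    by (rule closure_mono) auto
  then have inA: "min m (inverse (1 - \<nu>)) \<in> A" using ex \<nu> by (auto simp: A_def)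
  have bdA: "bdd_above A" by (rule bdd_aboveI[of _ "inverse (1 - \<nu>)"]) (simp add: A_def)
  have "0 < min m (inverse (1 - \<nu>))" using ex \<nu> by simp
  with cSup_upper[OF inA bdA] have S: "0 < Sup A" by linarith
  then have "\<nu> * Sup A < Sup A" using \<nu> by simp
  then obtain c where c: "c \<in> A" "\<nu> * Sup A < c" using less_cSupE inA by blast
  have lb: "level_bound D w \<nu> = \<nu> * Sup A" by (simp add: level_bound_def A_def)
  show ?thesis
  proof (rule that)
    show "x \<in> D" "w x < level_bound D w \<nu>" using \<nu> by auto
    have "closure {y \<in> D. w y < level_bound D w \<nu>} \<subseteq> closure {y \<in> D. w y < c}"
      using c by (intro closure_mono) (auto simp: lb)
    also have "\<dots> \<subseteq> D" using c by (simp add: A_def)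
    finally show "closure {y \<in> D. w y < level_bound D w \<nu>} \<subseteq> D" .
    show "{y \<in> D. w y < level_bound D w \<nu>} \<subseteq> next_domain D w"
      using \<nu> by (auto simp: next_domain_def)
  qed
qed

text \<open>Used at the origin, where the value function vanishes, so that 0 survives every
  shrinking of the domain. The choice \<nu> = 1/2, with cap 2, is one convenient member of the
  union.\<close>

lemma mem_next_domain:
  assumes ex: "0 < m" "closure {y \<in> D. w y < m} \<subseteq> D" and x: "x \<in> D" "w x \<le> 0"
  shows "x \<in> next_domain D w"
proof -
  define A where "A = {c \<in> {0<..inverse (1 - 1/2)}. closure {x\<in>D. w x < c} \<subseteq> D}"
  have "closure {y \<in> D. w y < min m 2} \<subseteq> closure {y \<in> D. w y < m}"
    by (rule closure_mono) auto
  then have inA: "min m 2 \<in> A" using ex by (auto simp: A_def)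
  have bdA: "bdd_above A" by (rule bdd_aboveI[of _ 2]) (simp add: A_def)
  have "0 < min m 2" using ex by simp
  with cSup_upper[OF inA bdA] have "0 < Sup A" by linarith
  then have "0 < level_bound D w (1/2)" by (simp add: level_bound_def A_def)
  then show ?thesis using x by (auto simp: next_domain_def intro!: bexI[of _ "1/2"])
qed

lemma open_next_domain: "open D \<Longrightarrow> continuous_on D w \<Longrightarrow> open (next_domain D w)"
proof -
  assume D: "open D" "continuous_on D w"
  have "open {x\<in>D. w x < c}" for c
  proof -
    have "{x\<in>D. w x < c} = D \<inter> w -` {..<c}" by auto
    then show ?thesis using continuous_open_preimage[OF D(2,1), of "{..<c}"] by simp
  qed
  then show ?thesis by (auto simp: next_domain_def)
qed

lemma next_domain_subset: "next_domain D w \<subseteq> D"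
  by (auto simp: next_domain_def)

section \<open>Gradients, quadratic costs and running costs\<close>

lemma grad_eqI:
  fixes w :: "real^'n \<Rightarrow> real"
  assumes "GDERIV w x :> D"
  shows "grad w x = D"
  unfolding grad_def using assms
proof (rule the_equality)
  fix D' assume "GDERIV w x :> D'"
  then have "(\<lambda>e. e \<bullet> D') = (\<lambda>e. e \<bullet> D)"
    using assms unfolding gderiv_def by (rule has_derivative_unique)
  then show "D' = D" by (metis vector_eq_ldot)
qed

text \<open>Bridge from directional derivatives to gradients: the Frechet derivative is represented
  by the vector of its values on the basis, and continuity is inherited coordinatewise.\<close>

lemma Ck_on_1_gderiv:
  fixes w :: "real^'n \<Rightarrow> real"
  assumes "Ck_on 1 S w"
  shows "\<And>x. x \<in> S \<Longrightarrow> GDERIV w x :> grad w x" and "continuous_on S (grad w)"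
proof -
  let ?g = "\<lambda>x. \<Sum>b\<in>Basis. frechet_derivative w (at x) b *\<^sub>R b"
  have gd: "GDERIV w x :> ?g x" if x: "x \<in> S" for x
  proof -
    have d: "(w has_derivative frechet_derivative w (at x)) (at x)"
      using assms x by (simp add: frechet_derivative_works)
    then interpret bounded_linear "frechet_derivative w (at x)" by (rule has_derivative_bounded_linear)
    have "frechet_derivative w (at x) e = e \<bullet> ?g x" for e
    proof -
      have "frechet_derivative w (at x) (\<Sum>b\<in>Basis. (e \<bullet> b) *\<^sub>R b) = e \<bullet> ?g x"
        by (simp add: sum scaleR inner_sum_right mult.commute)
      then show ?thesis by (simp add: euclidean_representation)
    qed
    then have "frechet_derivative w (at x) = (\<lambda>e. e \<bullet> ?g x)" by (rule ext)
    with d show ?thesis by (simp only: gderiv_def)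
  qed
  have eq: "grad w x = ?g x" if "x \<in> S" for x
    by (rule grad_eqI[OF gd[OF that]])
  show "GDERIV w x :> grad w x" if "x \<in> S" for x using gd[OF that] eq[OF that] by simp
  have "continuous_on S ?g" using assms by (intro continuous_intros) simp
  then show "continuous_on S (grad w)" using eq by (simp cong: continuous_on_cong)
qed

lemma Ck_on_1I:
  fixes w :: "real^'n \<Rightarrow> real"
  assumes G: "\<And>x. x \<in> S \<Longrightarrow> GDERIV w x :> G x" and c: "continuous_on S G"
  shows "Ck_on 1 S w"
proof -
  have "frechet_derivative w (at x) e = e \<bullet> G x" if "x \<in> S" for x e
    using frechet_derivative_at[OF G[OF that, unfolded gderiv_def]] by metis
  moreover have "continuous_on S (\<lambda>x. e \<bullet> G x)" for e by (intro continuous_intros c)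
  moreover have "w differentiable (at x)" if "x \<in> S" for x
    using G[OF that] unfolding gderiv_def by (rule differentiableI)
  ultimately show ?thesis by (simp cong: continuous_on_cong)
qed

lemma smooth_on_continuous_on: "smooth_on S w \<Longrightarrow> continuous_on S w"
  unfolding smooth_on_def using Ck_on.simps(1) by blast

lemma continuous_on_matrix_vector_mult [continuous_intros]:
  fixes A :: "'a::topological_space \<Rightarrow> real^'m^'n"
  assumes "continuous_on S A" "continuous_on S y"
  shows "continuous_on S (\<lambda>x. A x *v y x)"
  unfolding matrix_vector_mult_def by (intro continuous_intros assms)

lemma continuous_on_transpose [continuous_intros]:
  fixes A :: "'a::topological_space \<Rightarrow> real^'m^'n"
  assumes "continuous_on S A"
  shows "continuous_on S (\<lambda>x. transpose (A x))"
  unfolding transpose_def by (intro continuous_intros assms)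

lemma pos_def_matrix_nonneg: "pos_def_matrix R \<Longrightarrow> 0 \<le> y \<bullet> (R *v y)"
  by (cases "y = 0") (auto simp: pos_def_matrix_def less_imp_le)

lemma pos_def_matrix_inv:
  fixes R :: "real^'m^'m"
  assumes "pos_def_matrix R"
  shows "R *v (matrix_inv R *v y) = y"
proof -
  have "y = 0" if "R *v y = 0" for y
    using assms that by (force simp: pos_def_matrix_def)
  then have "invertible R"
    unfolding invertible_left_inverse matrix_left_invertible_ker by blast
  then have "R ** matrix_inv R = mat 1"
    unfolding invertible_def matrix_inv_def by (rule someI2_ex) simp
  then show ?thesis by (simp add: matrix_vector_mul_assoc)
qed

text \<open>For positive-definite \<open>R\<close> this is the minimizer over inputs
  \<open>a\<close> of the Hamiltonian
  \<open>p \<bullet> (y + B *v a) + a \<bullet> (R *v a)\<close>, whatever the drift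
  \<open>y\<close>.\<close>

definition improved_input :: "real^'m^'n \<Rightarrow> real^'m^'m \<Rightarrow> real^'n \<Rightarrow> real^'m" where
  "improved_input B R p = - (1/2) *\<^sub>R (matrix_inv R *v (transpose B *v p))"

text \<open>Since \<open>R *v b\<close> is minus one half of \<open>transpose B *v p\<close>, the
  linear term \<open>p \<bullet> (B *v a)\<close> equals
  \<open>- 2 * (a \<bullet> (R *v b))\<close>, and symmetry of \<open>R\<close> completes the
  square.\<close>

lemma hamiltonian_complete_square:
  fixes B :: "real^'m^'n" and R :: "real^'m^'m" and p y :: "real^'n" and a :: "real^'m"
  assumes R: "pos_def_matrix R"
  defines "b \<equiv> improved_input B R p"
  shows "p \<bullet> (y + B *v a) + a \<bullet> (R *v a) = (p \<bullet> y - b \<bullet> (R *v b)) + (a - b) \<bullet> (R *v (a - b))"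
proof -
  have sym: "u \<bullet> (R *v w) = w \<bullet> (R *v u)" for u w
    using R dot_lmul_matrix[of u R w] transpose_matrix_vector[of R u]
    by (simp add: pos_def_matrix_def inner_commute)
  have "R *v b = - (1/2) *\<^sub>R (transpose B *v p)"
    unfolding b_def improved_input_def matrix_vector_mult_scaleR pos_def_matrix_inv[OF R] ..
  then have "transpose B *v p = - 2 *\<^sub>R (R *v b)" by simp
  moreover have "p \<bullet> (B *v a) = (transpose B *v p) \<bullet> a"
    by (simp add: dot_lmul_matrix)
  ultimately have "p \<bullet> (B *v a) = - 2 * (a \<bullet> (R *v b))" by (simp add: inner_commute)
  then show ?thesis
    using sym[of b a]
    by (simp add: matrix_vector_mult_diff_distrib inner_diff_left inner_diff_right inner_add_right)
qed

section \<open>Running costs along trajectories\<close>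

lemma real_primitive_exists:
  fixes l :: "real \<Rightarrow> real"
  assumes "continuous_on {0..} l"
  obtains L where "L 0 = 0" "\<And>t. 0 \<le> t \<Longrightarrow> (L has_real_derivative l t) (at t)"
proof -
  \<comment> \<open>Extending \<open>l\<close> by a constant to negative times and integrating from
    -1 turns 0 into an interior point, so the primitive has a two-sided derivative there, as the
    fundamental theorem for nonnegative integrals expects.\<close>
  define l' where "l' t = l (max 0 t)" for t
  have l': "continuous_on {-1..b} l'" for b unfolding l'_def
    by (rule continuous_on_compose2[OF assms]) (auto intro!: continuous_intros)
  define L where "L t = integral {-1..t} l' - integral {-1..0} l'" for t
  show ?thesis
  proof (rule that)
    show "L 0 = 0" by (simp add: L_def)
    fix t :: real assume t: "0 \<le> t"
    have "((\<lambda>t. integral {-1..t} l') has_real_derivative l' t) (at t within {-1..t+1})"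
      by (rule integral_has_real_derivative[OF l']) (use t in auto)
    then have "((\<lambda>t. integral {-1..t} l') has_real_derivative l' t) (at t)"
      using at_within_interior[of t "{-1..t+1}"] t by (simp add: interior_atLeastAtMost_real)
    then have "(L has_real_derivative l' t - 0) (at t)"
      unfolding L_def by (intro DERIV_diff DERIV_const)
    then show "(L has_real_derivative l t) (at t)" using t by (simp add: l'_def)
  qed
qed

text \<open>The limit version computes the cost of an iterate exactly. The inequality serves the
  optimal trajectory, where the cost up to each finite time has to be bounded by the total.\<close>

lemma nn_integral_primitive:
  fixes l :: "real \<Rightarrow> real"
  assumes l: "continuous_on {0..} l" "\<And>t. 0 \<le> t \<Longrightarrow> 0 \<le> l t"
    and L: "L 0 = 0" "\<And>t. 0 \<le> t \<Longrightarrow> (L has_real_derivative l t) (at t)"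
  shows "0 \<le> T \<Longrightarrow> ennreal (L T) \<le> (\<integral>\<^sup>+t\<in>{0..}. ennreal (l t) \<partial>lebesgue)"
    and "(L \<longlongrightarrow> c) at_top \<Longrightarrow> (\<integral>\<^sup>+t\<in>{0..}. ennreal (l t) \<partial>lebesgue) = ennreal c"
proof -
  define l' where "l' t = l (max 0 t)" for t
  have "continuous_on UNIV l'" unfolding l'_def
    by (rule continuous_on_compose2[OF l(1)]) (auto intro!: continuous_intros)
  then have [measurable]: "l' \<in> borel_measurable borel" by (rule borel_measurable_continuous_onI)
  have eq: "(\<integral>\<^sup>+t\<in>{0..}. ennreal (l t) \<partial>lebesgue) = (\<integral>\<^sup>+t\<in>{0..}. ennreal (l' t) \<partial>lborel)"
    unfolding nn_integral_completion by (intro nn_integral_cong) (auto simp: l'_def indicator_def)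
  have D: "(L has_real_derivative l' t) (at t)" "0 \<le> l' t" if "0 \<le> t" for t
    using L(2)[OF that] l(2)[OF that] that by (auto simp: l'_def)
  show "ennreal (L T) \<le> (\<integral>\<^sup>+t\<in>{0..}. ennreal (l t) \<partial>lebesgue)" if T: "0 \<le> T"
  proof -
    have "ennreal (L T) = (\<integral>\<^sup>+t\<in>{0..T}. ennreal (l' t) \<partial>lborel)"
      using nn_integral_FTC_Icc[of l' 0 T L] D T L(1) by simp
    also have "\<dots> \<le> (\<integral>\<^sup>+t\<in>{0..}. ennreal (l' t) \<partial>lborel)"
      by (intro nn_integral_mono) (auto simp: indicator_def)
    finally show ?thesis unfolding eq .
  qed
  show "(\<integral>\<^sup>+t\<in>{0..}. ennreal (l t) \<partial>lebesgue) = ennreal c" if "(L \<longlongrightarrow> c) at_top"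
    unfolding eq using nn_integral_FTC_atLeast[of l' 0 L c] D that L(1) by simp
qed

lemma zero_derivative_imp_const:
  fixes V :: "real \<Rightarrow> real"
  assumes "\<And>t. 0 \<le> t \<Longrightarrow> (V has_real_derivative 0) (at t within {0..})" "0 \<le> t"
  shows "V t = V 0"
proof (rule antisym)
  show "V t \<le> V 0"
    by (rule real_derivative_nonpos_imp_le[of 0 t V "\<lambda>_. 0"]) (use assms in auto)
  have "- V t \<le> - V 0"
    by (rule real_derivative_nonpos_imp_le[of 0 t "\<lambda>t. - V t" "\<lambda>_. 0"])
      (use assms in \<open>auto intro!: derivative_eq_intros\<close>)
  then show "V 0 \<le> V t" by simp
qed

text \<open>The sum of \<open>w\<close> along the trajectory and the cost accumulated so far has
  derivative zero, so the total cost is the initial value minus the limit 0 of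
  \<open>w\<close>.\<close>

lemma nn_integral_running_cost:
  fixes X :: "real \<Rightarrow> 'a::euclidean_space"
  assumes X: "trajectory_in D F X" and G: "\<And>y. y \<in> D \<Longrightarrow> GDERIV w y :> G y"
    and ghjb: "\<And>y. y \<in> D \<Longrightarrow> G y \<bullet> F y = - l y"
    and l: "continuous_on D l" "\<And>y. y \<in> D \<Longrightarrow> 0 \<le> l y"
    and lim: "((\<lambda>t. w (X t)) \<longlongrightarrow> 0) at_top"
  shows "(\<integral>\<^sup>+t\<in>{0..}. ennreal (l (X t)) \<partial>lebesgue) = ennreal (w (X 0))"
proof -
  have lX: "continuous_on {0..} (\<lambda>t. l (X t))"
    by (rule continuous_on_compose2[OF l(1) trajectory_in_continuous[OF X]])
      (auto simp: trajectory_inD[OF X])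
  obtain L where L: "L 0 = 0" "\<And>t. 0 \<le> t \<Longrightarrow> (L has_real_derivative l (X t)) (at t)"
    using real_primitive_exists[OF lX] by blast
  have L_eq: "L t = w (X 0) - w (X t)" if t: "0 \<le> t" for t
  proof -
    have "w (X t) + L t = w (X 0) + L 0"
    proof (rule zero_derivative_imp_const[OF _ t])
      fix r :: real assume r: "0 \<le> r"
      have "((\<lambda>t. w (X t) + L t) has_real_derivative G (X r) \<bullet> F (X r) + l (X r)) (at r within {0..})"
        by (intro DERIV_add has_real_derivative_along trajectory_inD[OF X r] G
            has_field_derivative_at_within[OF L(2)[OF r]])
      then show "((\<lambda>t. w (X t) + L t) has_real_derivative 0) (at r within {0..})"
        using ghjb[OF trajectory_inD(1)[OF X r]] by simp
    qed
    then show ?thesis using L(1) by simp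
  qed
  have "((\<lambda>t. w (X 0) - w (X t)) \<longlongrightarrow> w (X 0) - 0) at_top" by (intro tendsto_intros lim)
  then have "(L \<longlongrightarrow> w (X 0) - 0) at_top"
    by (rule Lim_transform_eventually)
      (auto simp: L_eq eventually_at_top_linorder intro!: exI[of _ 0])
  then have "(L \<longlongrightarrow> w (X 0)) at_top" by simp
  moreover have "0 \<le> l (X t)" if "0 \<le> t" for t
    using l(2) trajectory_inD(1)[OF X that] .
  ultimately show ?thesis using nn_integral_primitive(2)[OF lX _ L] by blast
qed

text \<open>On a compact time interval the velocity is bounded by some \<open>B\<close>, so
  \<open>X\<close> is Lipschitz and \<delta> = \<epsilon> / \<open>B\<close> works.\<close>

lemma abs_continuous_of_trajectory:
  fixes X :: "real \<Rightarrow> 'a::euclidean_space"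
  assumes X: "trajectory_in D F X" and F: "continuous_on D F"
  shows "abs_continuous_on_interval 0 T X"
proof -
  have cX: "continuous_on {0..T} (\<lambda>t. F (X t))"
    by (rule continuous_on_compose2[OF F continuous_on_subset[OF trajectory_in_continuous[OF X]]])
      (auto simp: trajectory_inD[OF X])
  then have "bounded ((\<lambda>t. F (X t)) ` {0..T})"
    by (intro compact_imp_bounded compact_continuous_image) auto
  then obtain B where B: "0 < B" "\<And>t. t \<in> {0..T} \<Longrightarrow> norm (F (X t)) \<le> B"
    unfolding bounded_pos by blast
  have lip: "norm (X b - X a) \<le> B * (b - a)" if ab: "0 \<le> a" "a \<le> b" "b \<le> T" for a b
  proof -
    have "norm (X b - X a) \<le> B * norm (b - a)"
    proof (rule differentiable_bound[of "{0..T}"])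
      fix t assume t: "t \<in> {0..T}"
      show "(X has_derivative (\<lambda>h. h *\<^sub>R F (X t))) (at t within {0..T})"
        using trajectory_inD(2)[OF X, of t] t unfolding has_vector_derivative_def
        by (auto intro: has_derivative_subset)
      show "onorm (\<lambda>h. h *\<^sub>R F (X t)) \<le> B"
        using B(2)[OF t] by (intro onorm_bound) (auto simp: mult.commute[of B] mult_left_mono less_imp_le[OF B(1)])
    qed (use ab in auto)
    then show ?thesis using ab by simp
  qed
  show ?thesis unfolding abs_continuous_on_interval_def
  proof (intro allI impI)
    fix \<epsilon> :: real assume e: "0 < \<epsilon>"
    show "\<exists>\<delta>>0. \<forall>(k::nat) a b. (\<forall>i<k. 0 \<le> a i \<and> a i \<le> b i \<and> b i \<le> T) \<and>
        (\<forall>i<k. \<forall>j<k. i \<noteq> j \<longrightarrow> {a i<..<b i} \<inter> {a j<..<b j} = {}) \<and> (\<Sum>i<k. b i - a i) < \<delta>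
        \<longrightarrow> (\<Sum>i<k. norm (X (b i) - X (a i))) < \<epsilon>"
    proof (intro exI[of _ "\<epsilon> / B"] conjI allI impI)
      show "0 < \<epsilon> / B" using e B by simp
      fix k :: nat and a b :: "nat \<Rightarrow> real"
      assume h: "(\<forall>i<k. 0 \<le> a i \<and> a i \<le> b i \<and> b i \<le> T) \<and>
        (\<forall>i<k. \<forall>j<k. i \<noteq> j \<longrightarrow> {a i<..<b i} \<inter> {a j<..<b j} = {}) \<and> (\<Sum>i<k. b i - a i) < \<epsilon> / B"
      have "(\<Sum>i<k. norm (X (b i) - X (a i))) \<le> (\<Sum>i<k. B * (b i - a i))"
        by (rule sum_mono) (use h lip in auto)
      also have "\<dots> = B * (\<Sum>i<k. b i - a i)" by (simp add: sum_distrib_left)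
      also have "\<dots> < B * (\<epsilon> / B)" using h B by (intro mult_strict_left_mono) auto
      also have "\<dots> = \<epsilon>" using B by simp
      finally show "(\<Sum>i<k. norm (X (b i) - X (a i))) < \<epsilon>" .
    qed
  qed
qed

text \<open>Confinement to a set with compact closure, on which \<open>u\<close> is continuous,
  bounds the open-loop input generated by the feedback, so this input competes in the
  infimum.\<close>

lemma opt_value_le_closed_loop_cost:
  fixes X :: "real \<Rightarrow> real^'n" and u :: "real^'n \<Rightarrow> real^'m"
  assumes X: "trajectory_in W (\<lambda>y. f y + g y *v u y) X" "X 0 = x"
    and K: "compact (closure W)" "continuous_on (closure W) u"
    and fg: "continuous_on UNIV f" "continuous_on UNIV g"
  shows "opt_value f g h R x \<le> cost h R X (\<lambda>t. u (X t))"
proof -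
  have XW: "X t \<in> closure W" if "0 \<le> t" for t
    using trajectory_inD(1)[OF X(1) that] closure_subset by blast
  have uW: "continuous_on W u" using K(2) closure_subset by (rule continuous_on_subset)
  have "continuous_on {0..} (\<lambda>t. u (X t))"
    by (rule continuous_on_compose2[OF uW trajectory_in_continuous[OF X(1)]])
      (auto simp: trajectory_inD[OF X(1)])
  then have meas: "(\<lambda>t. u (X t)) \<in> borel_measurable (lebesgue_on {0..})"
    by (rule continuous_imp_measurable_on_sets_lebesgue) simp
  have "bounded (u ` closure W)" using K compact_continuous_image compact_imp_bounded by blast
  then obtain C where "\<And>y. y \<in> closure W \<Longrightarrow> norm (u y) \<le> C" unfolding bounded_iff by blast
  then have inp: "(\<lambda>t. u (X t)) \<in> input_functions"
    using meas XW unfolding input_functions_def by auto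
  have FW: "continuous_on W (\<lambda>y. f y + g y *v u y)"
    by (intro continuous_intros uW continuous_on_subset[OF fg(1)] continuous_on_subset[OF fg(2)]) auto
  have "caratheodory_solution f g (\<lambda>t. u (X t)) x X"
    unfolding caratheodory_solution_def
  proof (intro conjI allI impI AE_I2)
    show "abs_continuous_on_interval 0 T X" for T
      by (rule abs_continuous_of_trajectory[OF X(1) FW])
    fix t :: real assume t: "0 < t"
    have "at t within {0..} = at t"
      using t at_within_open_subset[of t "{0<..}" "{0..}"] by force
    then show "(X has_vector_derivative f (X t) + g (X t) *v u (X t)) (at t)"
      using trajectory_inD(2)[OF X(1), of t] t by simp
  qed (rule X(2))
  then show ?thesis unfolding opt_value_def using inp by (intro Inf_lower) blast
qed

section \<open>Monotonicity of the policy iteration\<close>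

locale policy_iteration_run =
  fixes f :: "real^'n \<Rightarrow> real^'n" and g :: "real^'n \<Rightarrow> real^'m^'n" and h :: "real^'n \<Rightarrow> real"
    and R :: "real^'m^'m" and \<Omega> :: "(real^'n) set" and u0 :: "real^'n \<Rightarrow> real^'m"
    and v :: "nat \<Rightarrow> real^'n \<Rightarrow> real" and u :: "nat \<Rightarrow> real^'n \<Rightarrow> real^'m"
    and Om :: "nat \<Rightarrow> (real^'n) set"
  assumes data: "data_assumption f g h R"
    and bounded_\<Omega>: "bounded \<Omega>"
    and adm: "admissible f g u0 \<Omega>"
    and iter: "policy_iteration f g h R u0 \<Omega> v u Om"
begin

abbreviation dom :: "nat \<Rightarrow> (real^'n) set" where
  "dom s \<equiv> prev_domain \<Omega> Om s"

definition closed_loop :: "nat \<Rightarrow> real^'n \<Rightarrow> real^'n" where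
  "closed_loop s y = f y + g y *v u s y"

definition run_cost :: "nat \<Rightarrow> real^'n \<Rightarrow> real" where
  "run_cost s y = h y + u s y \<bullet> (R *v u s y)"

text \<open>The induction invariant of the iteration. It asks for the existence of a convergent
  trajectory from each point, which is what a merely continuous feedback can deliver.\<close>

definition stabilizing :: "nat \<Rightarrow> bool" where
  "stabilizing s \<longleftrightarrow> open (dom s) \<and> 0 \<in> dom s \<and> continuous_on (dom s) (u s) \<and>
     (\<forall>x\<in>dom s. \<exists>X. X 0 = x \<and> trajectory_in (dom s) (closed_loop s) X \<and> (X \<longlongrightarrow> 0) at_top)"

lemma dom_Suc: "dom (Suc s) = Om s"
  by (simp add: prev_domain_def)

lemma cont_f: "continuous_on S f" and cont_g: "continuous_on S g" and cont_h: "continuous_on S h"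
  using data smooth_on_continuous_on continuous_on_subset[OF _ subset_UNIV]
  unfolding data_assumption_def by blast+

lemma pos_def_R: "pos_def_matrix R"
  using data by (simp add: data_assumption_def)

lemma h_zero: "h 0 = 0" and h_pos: "x \<noteq> 0 \<Longrightarrow> 0 < h x"
  using data by (simp_all add: data_assumption_def)

lemma h_nonneg: "0 \<le> h x"
  using h_zero h_pos[of x] by (cases "x = 0") auto

lemma run_cost_ge: "h y \<le> run_cost s y"
  unfolding run_cost_def using pos_def_matrix_nonneg[OF pos_def_R] by simp

lemma v_C1: "Ck_on 1 (dom s) (v s)"
  using iter unfolding policy_iteration_def Let_def by blast

lemmas gderiv_v = Ck_on_1_gderiv(1)[OF v_C1]
lemmas cont_grad_v = Ck_on_1_gderiv(2)[OF v_C1]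

lemma cont_v: "continuous_on (dom s) (v s)"
  by (rule GDERIV_continuous_on) (rule gderiv_v)

lemma v_zero: "v s 0 = 0"
  using iter unfolding policy_iteration_def Let_def by blast

lemma ghjb:
  assumes "x \<in> dom s"
  shows "grad (v s) x \<bullet> closed_loop s x = - run_cost s x"
proof -
  have "(f x + g x *v u s x) \<bullet> grad (v s) x + h x + u s x \<bullet> (R *v u s x) = 0"
    using iter assms unfolding policy_iteration_def Let_def by blast
  then show ?thesis by (simp add: closed_loop_def run_cost_def inner_commute)
qed

lemma u_Suc: "x \<in> dom s \<Longrightarrow> u (Suc s) x = improved_input (g x) R (grad (v s) x)"
proof -
  assume "x \<in> dom s"
  moreover have "\<forall>x\<in>dom s. u (Suc s) x = - (1/2) *\<^sub>R (matrix_inv R *v (transpose (g x) *v grad (v s) x))"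
    using iter unfolding policy_iteration_def Let_def by blast
  ultimately show ?thesis unfolding improved_input_def by (rule bspec[rotated])
qed

lemma Om_eq: "Om s = next_domain (dom s) (v s)"
  using iter unfolding policy_iteration_def Let_def by blast

lemma Om_subset_dom: "Om s \<subseteq> dom s"
  unfolding Om_eq[of s] by (rule next_domain_subset)

lemma dom_subset: "dom s \<subseteq> \<Omega>"
proof (induction s)
  case (Suc s)
  then show ?case using Om_subset_dom[of s] by (simp add: dom_Suc)
qed (simp add: prev_domain_def)

lemma bounded_dom: "bounded (dom s)"
  using bounded_\<Omega> dom_subset by (rule bounded_subset)

lemma compact_closure_sublevel: "compact (closure {y \<in> dom s. v s y < c})"
  unfolding compact_closure by (rule bounded_subset[OF bounded_dom[of s]]) auto

lemma continuous_on_improved_input: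
  "continuous_on S p \<Longrightarrow> continuous_on S (\<lambda>x. improved_input (g x) R (p x))"
  unfolding improved_input_def by (intro continuous_intros cont_g)

lemma cont_u_Suc: "continuous_on (dom s) (u (Suc s))"
  using continuous_on_improved_input[OF cont_grad_v] u_Suc by (simp cong: continuous_on_cong)

lemma cont_closed_loop: "continuous_on S (u s) \<Longrightarrow> continuous_on S (closed_loop s)"
  unfolding closed_loop_def by (intro continuous_intros cont_f cont_g)

lemma cont_run_cost: "continuous_on S (u s) \<Longrightarrow> continuous_on S (run_cost s)"
  unfolding run_cost_def by (intro continuous_intros cont_h)

text \<open>The Hamiltonian of \<open>grad (v s)\<close> equals \<open>- h x\<close> at the old
  input, by the iteration equation. The new input minimizes it, and the gap is the nonnegative
  quadratic form in the difference of the two inputs.\<close>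

lemma improvement:
  assumes x: "x \<in> dom s"
  shows "grad (v s) x \<bullet> closed_loop (Suc s) x \<le> - run_cost (Suc s) x"
proof -
  let ?p = "grad (v s) x" and ?a = "u s x" and ?b = "u (Suc s) x"
  have b: "?b = improved_input (g x) R ?p" by (rule u_Suc[OF x])
  have "?p \<bullet> (f x + g x *v ?a) + ?a \<bullet> (R *v ?a)
      = (?p \<bullet> f x - ?b \<bullet> (R *v ?b)) + (?a - ?b) \<bullet> (R *v (?a - ?b))"
    unfolding b by (rule hamiltonian_complete_square[OF pos_def_R])
  moreover have "?p \<bullet> (f x + g x *v ?b) + ?b \<bullet> (R *v ?b) = ?p \<bullet> f x - ?b \<bullet> (R *v ?b)"
    unfolding b by (subst hamiltonian_complete_square[OF pos_def_R]) simp
  moreover have "0 \<le> (?a - ?b) \<bullet> (R *v (?a - ?b))" by (rule pos_def_matrix_nonneg[OF pos_def_R])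
  ultimately show ?thesis
    using ghjb[OF x] unfolding closed_loop_def run_cost_def by linarith
qed

text \<open>The same function is a Lyapunov function for two controllers. Descent under the old one
  yields positivity and a compact sublevel set; descent under the improved one yields invariance of
  sublevel sets and convergence.\<close>

lemma grad_v_descent:
  assumes "x \<in> dom s"
  shows "grad (v s) x \<bullet> closed_loop s x \<le> - h x" "grad (v s) x \<bullet> closed_loop (Suc s) x \<le> - h x"
    "grad (v s) x \<bullet> closed_loop s x \<le> 0" "grad (v s) x \<bullet> closed_loop (Suc s) x \<le> 0"
  using ghjb[OF assms] improvement[OF assms] run_cost_ge[of x s] run_cost_ge[of x "Suc s"]
    h_nonneg[of x] by linarith+

lemma v_pos:
  assumes "stabilizing s" "x \<in> dom s" "x \<noteq> 0"
  shows "0 < v s x"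
proof -
  obtain X where X: "X 0 = x" "trajectory_in (dom s) (closed_loop s) X" "(X \<longlongrightarrow> 0) at_top"
    using assms unfolding stabilizing_def by blast
  show ?thesis
    by (rule value_pos[OF _ _ X(2,3,1) gderiv_v v_zero grad_v_descent(1) h_zero h_pos assms(3)])
      (use assms(1) in \<open>auto simp: stabilizing_def\<close>)
qed

lemma compact_sublevel:
  assumes "stabilizing s"
  obtains m where "0 < m" "closure {y \<in> dom s. v s y < m} \<subseteq> dom s"
proof (rule compact_sublevel_exists[of "dom s" "closed_loop s" "v s" "grad (v s)"])
  show "0 < v s y" if "y \<in> dom s" "y \<noteq> 0" for y by (rule v_pos[OF assms that])
qed (use assms gderiv_v grad_v_descent(3) in \<open>auto simp: stabilizing_def\<close>)

text \<open>The sublevel set is kept in the conclusion because its two inclusions have different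
  uses: its closure in \<open>dom s\<close> is where \<open>u (Suc s)\<close> is bounded, while the
  set itself in \<open>Om s\<close> gives a trajectory that remains in the new domain.\<close>

lemma improved_trajectory:
  assumes s: "stabilizing s" and x: "x \<in> Om s"
  obtains X c where "X 0 = x" "(X \<longlongrightarrow> 0) at_top"
    "trajectory_in {y \<in> dom s. v s y < c} (closed_loop (Suc s)) X"
    "closure {y \<in> dom s. v s y < c} \<subseteq> dom s" "{y \<in> dom s. v s y < c} \<subseteq> Om s"
proof -
  obtain m where m: "0 < m" "closure {y \<in> dom s. v s y < m} \<subseteq> dom s" by (rule compact_sublevel[OF s])
  obtain c where c: "x \<in> dom s" "v s x < c" "closure {y \<in> dom s. v s y < c} \<subseteq> dom s"
    "{y \<in> dom s. v s y < c} \<subseteq> Om s"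
    using next_domain_sublevel[OF m x[unfolded Om_eq[of s]]] unfolding Om_eq[of s] by blast
  have op: "open (dom s)" using s by (simp add: stabilizing_def)
  obtain X where X: "X 0 = x" "trajectory_in {y \<in> dom s. v s y < c} (closed_loop (Suc s)) X"
    using sublevel_trajectory_exists[OF op bounded_dom cont_closed_loop[OF cont_u_Suc] gderiv_v
        grad_v_descent(4) c(3,1,2)] by blast
  have "(X \<longlongrightarrow> 0) at_top"
    by (rule lyapunov_trajectory_tendsto_0[OF X(2) compact_closure_sublevel c(3) gderiv_v v_zero v_pos[OF s]
          grad_v_descent(2) cont_h h_zero h_pos])
  then show ?thesis using that X c by blast
qed

lemma stabilizing_Suc:
  assumes s: "stabilizing s"
  shows "stabilizing (Suc s)"
proof -
  obtain m where m: "0 < m" "closure {y \<in> dom s. v s y < m} \<subseteq> dom s" by (rule compact_sublevel[OF s])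
  have op: "open (dom s)" "0 \<in> dom s" using s by (simp_all add: stabilizing_def)
  show ?thesis unfolding stabilizing_def dom_Suc
  proof (intro conjI ballI)
    show "open (Om s)" unfolding Om_eq[of s] by (rule open_next_domain[OF op(1) cont_v])
    show "0 \<in> Om s" unfolding Om_eq[of s] by (rule mem_next_domain[OF m op(2)]) (simp add: v_zero)
    show "continuous_on (Om s) (u (Suc s))" using cont_u_Suc Om_subset_dom by (rule continuous_on_subset)
    fix x assume "x \<in> Om s"
    then show "\<exists>X. X 0 = x \<and> trajectory_in (Om s) (closed_loop (Suc s)) X \<and> (X \<longlongrightarrow> 0) at_top"
      by (rule improved_trajectory[OF s]) (blast intro: trajectory_in_mono)
  qed
qed

lemma stabilizing_0: "stabilizing 0"
proof -
  have u0: "u 0 x = u0 x" if "x \<in> \<Omega>" for x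
    using iter that unfolding policy_iteration_def by blast
  have dom0: "dom 0 = \<Omega>" by (simp add: prev_domain_def)
  obtain \<phi> where \<phi>: "closed_loop_flow f g u0 \<Omega> \<phi>" "\<forall>x\<in>\<Omega>. ((\<lambda>t. norm (\<phi> x t)) \<longlongrightarrow> 0) at_top"
    using adm unfolding admissible_def by blast
  show ?thesis unfolding stabilizing_def dom0
  proof (intro conjI ballI)
    show "open \<Omega>" "0 \<in> \<Omega>" using adm by (auto simp: admissible_def domain_def)
    show "continuous_on \<Omega> (u 0)"
      using adm u0 by (simp add: admissible_def cong: continuous_on_cong)
    fix x assume x: "x \<in> \<Omega>"
    show "\<exists>X. X 0 = x \<and> trajectory_in \<Omega> (closed_loop 0) X \<and> (X \<longlongrightarrow> 0) at_top"
    proof (intro exI[of _ "\<phi> x"] conjI)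
      show "\<phi> x 0 = x" using \<phi> x by (auto simp: closed_loop_flow_def)
      show "(\<phi> x \<longlongrightarrow> 0) at_top" using \<phi>(2) x tendsto_norm_zero_iff by blast
      show "trajectory_in \<Omega> (closed_loop 0) (\<phi> x)"
        using \<phi>(1) x u0 by (simp add: trajectory_in_def closed_loop_flow_def closed_loop_def)
    qed
  qed
qed

lemma stabilizing: "stabilizing s"
  by (induction s) (auto intro: stabilizing_0 stabilizing_Suc)

lemma v_nonneg: "x \<in> dom s \<Longrightarrow> 0 \<le> v s x"
  using v_pos[OF stabilizing, of x s] v_zero[of s] by (cases "x = 0") auto

text \<open>Along an improved trajectory \<open>v s\<close> falls at least as fast as the running
  cost and \<open>v (Suc s)\<close> falls exactly as fast. Their difference therefore decreases, and
  its limit is 0, so it is nonnegative at the start.\<close>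

lemma v_Suc_le:
  assumes x: "x \<in> Om s"
  shows "v (Suc s) x \<le> v s x"
proof -
  obtain X c where X: "X 0 = x" "(X \<longlongrightarrow> 0) at_top"
    "trajectory_in {y \<in> dom s. v s y < c} (closed_loop (Suc s)) X" "{y \<in> dom s. v s y < c} \<subseteq> Om s"
    by (rule improved_trajectory[OF stabilizing x])
  have XO: "trajectory_in (Om s) (closed_loop (Suc s)) X" by (rule trajectory_in_mono[OF X(3,4)])
  let ?w = "\<lambda>y. v s y - v (Suc s) y" and ?G = "\<lambda>y. grad (v s) y - grad (v (Suc s)) y"
  have G: "GDERIV ?w y :> ?G y" if "y \<in> Om s" for y
    using that Om_subset_dom by (intro GDERIV_diff gderiv_v) (auto simp: dom_Suc)
  have desc: "?G y \<bullet> closed_loop (Suc s) y \<le> 0" if y: "y \<in> Om s" for y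
    using improvement[of y s] ghjb[of y "Suc s"] y Om_subset_dom[of s]
    by (auto simp: dom_Suc inner_diff_left)
  have lim: "((\<lambda>t. ?w (X t)) \<longlongrightarrow> 0) at_top"
    by (rule value_tendsto_0[OF _ _ G _ X(2)])
      (use stabilizing[of "Suc s"] in \<open>auto simp: stabilizing_def dom_Suc v_zero\<close>)
  have "0 \<le> ?w (X 0)"
  proof (rule tendsto_upperbound[OF lim])
    show "\<forall>\<^sub>F t::real in at_top. ?w (X t) \<le> ?w (X 0)"
      unfolding eventually_at_top_linorder
      using trajectory_descent[OF XO G desc, of 0] by (intro exI[of _ 0]) auto
  qed simp
  then show ?thesis using X(1) by simp
qed

text \<open>\<open>v (Suc s) x\<close> is exactly the cost of a closed-loop trajectory of
  \<open>u (Suc s)\<close> from \<open>x\<close>. The index is shifted because this trajectory must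
  lie in \<open>Om s\<close>, the domain of \<open>v (Suc s)\<close>.\<close>

lemma opt_value_le_v:
  assumes x: "x \<in> Om s"
  shows "opt_value f g h R x \<le> ereal (v (Suc s) x)"
proof -
  obtain X c where X: "X 0 = x" "(X \<longlongrightarrow> 0) at_top"
    and XW: "trajectory_in {y \<in> dom s. v s y < c} (closed_loop (Suc s)) X"
    and cl: "closure {y \<in> dom s. v s y < c} \<subseteq> dom s" "{y \<in> dom s. v s y < c} \<subseteq> Om s"
    by (rule improved_trajectory[OF stabilizing x])
  have XO: "trajectory_in (Om s) (closed_loop (Suc s)) X" by (rule trajectory_in_mono[OF XW cl(2)])
  have "opt_value f g h R x \<le> cost h R X (\<lambda>t. u (Suc s) (X t))"
    by (rule opt_value_le_closed_loop_cost[OF XW[unfolded closed_loop_def[abs_def]] X(1) compact_closure_sublevel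
          continuous_on_subset[OF cont_u_Suc cl(1)] cont_f cont_g])
  also have "\<dots> = enn2ereal (\<integral>\<^sup>+t\<in>{0..}. ennreal (run_cost (Suc s) (X t)) \<partial>lebesgue)"
    by (simp add: cost_def run_cost_def)
  also have "(\<integral>\<^sup>+t\<in>{0..}. ennreal (run_cost (Suc s) (X t)) \<partial>lebesgue) = ennreal (v (Suc s) (X 0))"
  proof (rule nn_integral_running_cost[OF XO])
    show "GDERIV (v (Suc s)) y :> grad (v (Suc s)) y" if "y \<in> Om s" for y
      using gderiv_v[of y "Suc s"] that by (simp add: dom_Suc)
    show "grad (v (Suc s)) y \<bullet> closed_loop (Suc s) y = - run_cost (Suc s) y" if "y \<in> Om s" for y
      using ghjb[of y "Suc s"] that by (simp add: dom_Suc)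
    show "continuous_on (Om s) (run_cost (Suc s))"
      by (rule cont_run_cost[OF continuous_on_subset[OF cont_u_Suc Om_subset_dom]])
    show "0 \<le> run_cost (Suc s) y" for y
      using run_cost_ge[of y "Suc s"] h_nonneg[of y] by linarith
    show "((\<lambda>t. v (Suc s) (X t)) \<longlongrightarrow> 0) at_top"
      by (rule value_tendsto_0[OF _ _ gderiv_v v_zero X(2)])
        (use stabilizing[of "Suc s"] in \<open>auto simp: stabilizing_def\<close>)
  qed
  also have "enn2ereal (ennreal (v (Suc s) (X 0))) = ereal (v (Suc s) x)"
    using v_nonneg[of x "Suc s"] x X(1) by (simp add: dom_Suc)
  finally show ?thesis .
qed

end

section \<open>Monotone limits with equi-Lipschitz gradients\<close>

text \<open>The sets where the error is still at least \<open>e\<close> are compact, decreasing in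
  \<open>n\<close>, and have empty intersection by pointwise convergence, so one of them is already
  empty.\<close>

lemma Dini_decreasing:
  fixes w :: "nat \<Rightarrow> 'a::heine_borel \<Rightarrow> real"
  assumes K: "compact K" and w: "\<And>n. continuous_on K (w n)" and V: "continuous_on K V"
    and dec: "\<And>n x. x \<in> K \<Longrightarrow> w (Suc n) x \<le> w n x"
    and lim: "\<And>x. x \<in> K \<Longrightarrow> (\<lambda>n. w n x) \<longlonglongrightarrow> V x"
  shows "uniform_limit K w V sequentially"
proof (rule uniform_limitI)
  fix e :: real assume e: "0 < e"
  have dec': "w n x \<le> w m x" if "m \<le> n" "x \<in> K" for m n x
    using decseqD[OF decseq_SucI[of "\<lambda>n. w n x"] that(1)] dec that(2) by blast
  have ge: "V x \<le> w n x" if "x \<in> K" for n x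
    using lim[OF that] dec'[OF _ that] by (intro LIMSEQ_le_const2) auto
  define C where "C n = K \<inter> (\<lambda>x. w n x - V x) -` {e..}" for n
  have "compact (C n)" for n
  proof -
    have "closed (C n)" unfolding C_def
      by (intro continuous_closed_preimage continuous_intros w V compact_imp_closed K closed_atLeast)
    moreover have "C n = K \<inter> C n" by (auto simp: C_def)
    ultimately show ?thesis using compact_Int_closed[OF K] by metis
  qed
  moreover have "C n \<subseteq> C m" if "m \<le> n" for m n
    using dec'[OF that] by (fastforce simp: C_def)
  moreover have "\<Inter> (range C) = {}"
  proof -
    have "\<exists>n. x \<notin> C n" if x: "x \<in> K" for x
    proof -
      have "\<forall>\<^sub>F n in sequentially. w n x < V x + e"
        using lim[OF x] e by (intro order_tendstoD) auto
      then obtain n where "w n x < V x + e" by (auto simp: eventually_sequentially)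
      then show ?thesis by (intro exI[of _ n]) (auto simp: C_def)
    qed
    then show ?thesis by (auto simp: C_def)
  qed
  ultimately obtain n where n: "C n = {}" using compact_nest[of C] by blast
  show "\<forall>\<^sub>F n in sequentially. \<forall>x\<in>K. dist (w n x) (V x) < e"
    unfolding eventually_sequentially
  proof (intro exI allI impI ballI)
    fix m x assume m: "n \<le> m" and x: "x \<in> K"
    have "x \<notin> C n" using n by simp
    then have "w n x - V x < e" using x by (auto simp: C_def)
    then show "dist (w m x) (V x) < e" using dec'[OF m x] ge[OF x, of m] by (simp add: dist_real_def)
  qed
qed

text \<open>A Landau-type inequality: a small function with Lipschitz gradient has a small gradient.\<close>

lemma norm_gradient_le:
  fixes w :: "'a::euclidean_space \<Rightarrow> real"
  assumes t: "0 < t"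
    and G: "\<And>y. y \<in> cball x t \<Longrightarrow> GDERIV w y :> G y"
    and L: "\<And>y. y \<in> cball x t \<Longrightarrow> norm (G x - G y) \<le> L * norm (x - y)" "0 \<le> L"
    and e: "\<And>y. y \<in> cball x t \<Longrightarrow> \<bar>w y\<bar> \<le> e"
  shows "norm (G x) \<le> 2 * e / t + L * t"
proof (cases "G x = 0")
  case True
  have "0 \<le> e" using e[of x] t by auto
  then show ?thesis using True t L by simp
next
  case False
  \<comment> \<open>The normalized gradient: the mean value theorem along this direction over
    distance \<open>t\<close> sees the full norm of \<open>G x\<close>, up to the Lipschitz
    error.\<close>
  define d where "d = sgn (G x)"
  have d: "norm d = 1" "G x \<bullet> d = norm (G x)"
    using False by (auto simp: d_def norm_sgn sgn_div_norm power2_norm_eq_inner[symmetric] power2_eq_square)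
  have inc: "x + r *\<^sub>R d \<in> cball x t" if "0 \<le> r" "r \<le> t" for r
    using that d by (simp add: dist_norm)
  have "\<exists>r\<in>{0<..<t}. w (x + t *\<^sub>R d) - w (x + 0 *\<^sub>R d) = (G (x + r *\<^sub>R d) \<bullet> d) * (t - 0)"
  proof (rule mvt_simple[OF t])
    fix r assume r: "0 \<le> r" "r \<le> t"
    have "((\<lambda>r. x + r *\<^sub>R d) has_vector_derivative d) (at r within {0..t})"
      by (auto intro!: derivative_eq_intros)
    from has_real_derivative_along[OF this G[OF inc[OF r]]]
    show "((\<lambda>r. w (x + r *\<^sub>R d)) has_derivative (*) (G (x + r *\<^sub>R d) \<bullet> d)) (at r within {0..t})"
      by (simp add: has_field_derivative_def)
  qed
  then obtain r where r: "0 < r" "r < t" "w (x + t *\<^sub>R d) - w x = (G (x + r *\<^sub>R d) \<bullet> d) * t" by auto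
  have "norm (G x) - G (x + r *\<^sub>R d) \<bullet> d = (G x - G (x + r *\<^sub>R d)) \<bullet> d"
    by (simp add: inner_diff_left d)
  also have "\<dots> \<le> norm (G x - G (x + r *\<^sub>R d))" using norm_cauchy_schwarz[of _ d] d(1) by simp
  also have "\<dots> \<le> L * norm (x - (x + r *\<^sub>R d))"
    by (rule L(1)[OF inc]) (use r in auto)
  also have "\<dots> \<le> L * t" using L(2) r d(1) by (intro mult_left_mono) auto
  finally have a: "norm (G x) \<le> G (x + r *\<^sub>R d) \<bullet> d + L * t" by simp
  have "(G (x + r *\<^sub>R d) \<bullet> d) * t \<le> 2 * e"
    using e[OF inc, of t] e[of x] r t by auto
  then have "G (x + r *\<^sub>R d) \<bullet> d \<le> 2 * e / t" using t by (simp add: pos_le_divide_eq)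
  with a show ?thesis by linarith
qed

lemma abs_diff_le_gradient_bound:
  fixes w :: "'a::euclidean_space \<Rightarrow> real"
  assumes S: "convex S" and G: "\<And>y. y \<in> S \<Longrightarrow> GDERIV w y :> G y" and B: "\<And>y. y \<in> S \<Longrightarrow> norm (G y) \<le> B"
    and xy: "x \<in> S" "y \<in> S"
  shows "\<bar>w x - w y\<bar> \<le> B * norm (x - y)"
proof -
  have "norm (w x - w y) \<le> B * norm (x - y)"
  proof (rule differentiable_bound[OF S _ _ xy])
    fix z assume z: "z \<in> S"
    show "(w has_derivative (\<lambda>h. h \<bullet> G z)) (at z within S)"
      using G[OF z] unfolding gderiv_def by (rule has_derivative_at_withinI)
    have "norm (h \<bullet> G z) \<le> B * norm h" for h
    proof -
      have "norm (h \<bullet> G z) \<le> norm h * norm (G z)" using Cauchy_Schwarz_ineq2[of h "G z"] by simp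
      also have "\<dots> \<le> norm h * B" using B[OF z] by (intro mult_left_mono) auto
      finally show ?thesis by (simp add: mult.commute)
    qed
    then show "onorm (\<lambda>h. h \<bullet> G z) \<le> B" by (rule onorm_le)
  qed
  then show ?thesis by simp
qed

text \<open>The Lipschitz hypothesis speaks of convex pieces of \<open>K\<close>, since a Hessian
  bound on \<open>K\<close> controls gradient differences only along segments inside
  \<open>K\<close>. Balls around the points of a smaller compact set provide such pieces.\<close>

lemma decreasing_C1_limit:
  fixes w :: "nat \<Rightarrow> 'a::euclidean_space \<Rightarrow> real"
  assumes S: "open S"
    and G: "\<And>n x. x \<in> S \<Longrightarrow> GDERIV (w n) x :> G n x" and cG: "\<And>n. continuous_on S (G n)"
    and dec: "\<And>n x. x \<in> S \<Longrightarrow> w (Suc n) x \<le> w n x"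
    and lim: "\<And>x. x \<in> S \<Longrightarrow> (\<lambda>n. w n x) \<longlonglongrightarrow> V x"
    and bnd: "\<And>K. compact K \<Longrightarrow> K \<subseteq> S \<Longrightarrow> \<exists>B. \<forall>n. \<forall>x\<in>K. norm (G n x) \<le> B"
    and lip: "\<And>K. compact K \<Longrightarrow> K \<subseteq> S \<Longrightarrow> \<exists>L\<ge>0. \<forall>n C. convex C \<longrightarrow> C \<subseteq> K \<longrightarrow>
        (\<forall>x\<in>C. \<forall>y\<in>C. norm (G n x - G n y) \<le> L * norm (x - y))"
  obtains P where "\<And>x. x \<in> S \<Longrightarrow> GDERIV V x :> P x" "continuous_on S P"
    "\<And>K. compact K \<Longrightarrow> K \<subseteq> S \<Longrightarrow> uniform_limit K w V sequentially"
    "\<And>K. compact K \<Longrightarrow> K \<subseteq> S \<Longrightarrow> uniform_limit K G P sequentially"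
proof -
  have cw: "continuous_on S (w n)" for n by (rule GDERIV_continuous_on) (rule G)
  \<comment> \<open>Dini's theorem needs a continuous limit. The common gradient bound makes all
    \<open>w n\<close> Lipschitz on a ball with one constant, and this constant passes to
    \<open>V\<close>.\<close>
  have "isCont V a" if a: "a \<in> S" for a
  proof -
    obtain r where r: "0 < r" "cball a r \<subseteq> S" using S a open_contains_cball by blast
    obtain B where B: "\<And>n x. x \<in> cball a r \<Longrightarrow> norm (G n x) \<le> B"
      using bnd[OF compact_cball r(2)] by blast
    have "\<bar>V x - V y\<bar> \<le> B * norm (x - y)" if xy: "x \<in> cball a r" "y \<in> cball a r" for x y
    proof (rule tendsto_upperbound)
      have "x \<in> S" "y \<in> S" using xy r(2) by auto
      then show "(\<lambda>n. \<bar>w n x - w n y\<bar>) \<longlonglongrightarrow> \<bar>V x - V y\<bar>" by (intro tendsto_intros lim)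
      have "\<bar>w n x - w n y\<bar> \<le> B * norm (x - y)" for n
        by (rule abs_diff_le_gradient_bound[OF convex_cball _ _ xy, of "w n" "G n"])
          (use r B G in blast)+
      then show "\<forall>\<^sub>F n in sequentially. \<bar>w n x - w n y\<bar> \<le> B * norm (x - y)" by simp
    qed simp
    moreover have "0 \<le> B" using B[of a 0] r norm_ge_zero[of "G 0 a"] by (meson centre_in_cball less_imp_le order_trans)
    ultimately have "B-lipschitz_on (cball a r) V"
      by (intro lipschitz_onI) (auto simp: dist_norm)
    then have "continuous_on (cball a r) V" by (rule lipschitz_on_continuous_on)
    then show ?thesis by (rule continuous_on_interior) (use r in simp)
  qed
  then have cV: "continuous_on S V" by (simp add: continuous_at_imp_continuous_on)
  have unif: "uniform_limit K w V sequentially" if K: "compact K" "K \<subseteq> S" for K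
    using K by (intro Dini_decreasing continuous_on_subset[OF cw] continuous_on_subset[OF cV] dec lim) auto
  have ucon: "uniformly_convergent_on K G" if K: "compact K" "K \<subseteq> S" for K
  proof (rule Cauchy_uniformly_convergent, rule uniformly_Cauchy_onI)
    fix \<epsilon> :: real assume \<epsilon>: "0 < \<epsilon>"
    obtain \<rho> where \<rho>: "0 < \<rho>" "(\<Union>x\<in>K. cball x \<rho>) \<subseteq> S"
      using compact_subset_open_imp_cball_epsilon_subset[OF K(1) S K(2)] by blast
    \<comment> \<open>A compact neighbourhood of \<open>K\<close> inside \<open>S\<close> that
      leaves room for balls; it is written as a sum of two sets so that compactness of sums
      applies.\<close>
    define K' where "K' = (\<Union>x\<in>K. \<Union>y\<in>cball 0 \<rho>. {x + y})"
    have K'_eq: "K' = (\<Union>x\<in>K. cball x \<rho>)"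
    proof -
      have "(\<Union>y\<in>cball 0 \<rho>. {x + y}) = cball x \<rho>" for x :: 'a
        using cball_translation[of x 0 \<rho>] unfolding UNION_singleton_eq_range by simp
      then show ?thesis by (simp add: K'_def)
    qed
    have K': "compact K'" unfolding K'_def by (rule compact_sums'[OF K(1) compact_cball])
    have K'S: "K' \<subseteq> S" using \<rho> K'_eq by simp
    from lip[OF K' K'S] obtain L where L0: "0 \<le> L" and Lip: "\<forall>n C. convex C \<longrightarrow> C \<subseteq> K' \<longrightarrow>
        (\<forall>x\<in>C. \<forall>y\<in>C. norm (G n x - G n y) \<le> L * norm (x - y))" by (elim exE conjE)
    have L: "norm (G n x - G n y) \<le> L * norm (x - y)"
      if "convex C" "C \<subseteq> K'" "x \<in> C" "y \<in> C" for n C x y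
      using Lip that by simp
    \<comment> \<open>The radius balances the two terms of the gradient inequality: it is small
      enough for the Lipschitz term \<open>2 * L * t\<close> to stay below \<epsilon>.\<close>
    define t where "t = min \<rho> (\<epsilon> / (4 * (L + 1)))"
    have t: "0 < t" "t \<le> \<rho>" using \<epsilon> L0 \<rho> by (auto simp: t_def)
    have "2 * L * t \<le> 2 * L * (\<epsilon> / (4 * (L + 1)))" using L0 by (intro mult_left_mono) (auto simp: t_def)
    also have "\<dots> < \<epsilon>" using L0 \<epsilon> by (simp add: field_simps add_pos_nonneg)
    finally have tL: "2 * L * t < \<epsilon>" .
    \<comment> \<open>Chosen so that the function-value term \<open>2 * (2 * \<eta>) / t\<close> is
      half of the margin left by the Lipschitz term.\<close>
    define \<eta> where "\<eta> = (\<epsilon> - 2 * L * t) * t / 8"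
    have \<eta>: "0 < \<eta>" using tL t by (simp add: \<eta>_def)
    obtain N where N: "\<And>n y. n \<ge> N \<Longrightarrow> y \<in> K' \<Longrightarrow> \<bar>w n y - V y\<bar> < \<eta>"
      using uniform_limitD[OF unif[OF K' K'S] \<eta>] by (auto simp: eventually_sequentially dist_real_def)
    show "\<exists>M. \<forall>x\<in>K. \<forall>m\<ge>M. \<forall>n\<ge>M. dist (G m x) (G n x) < \<epsilon>"
    proof (intro exI[of _ N] ballI allI impI)
      fix x m n assume x: "x \<in> K" and mn: "N \<le> m" "N \<le> n"
      have sub: "cball x t \<subseteq> K'" using x t(2) by (force simp: K'_eq)
      have "norm (G m x - G n x) \<le> 2 * (2 * \<eta>) / t + (2 * L) * t"
      proof (rule norm_gradient_le[OF t(1), of x "\<lambda>y. w m y - w n y" "\<lambda>y. G m y - G n y"])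
        fix y assume y: "y \<in> cball x t"
        then have yK: "y \<in> K'" using sub by blast
        then show "GDERIV (\<lambda>y. w m y - w n y) y :> G m y - G n y"
          using K'S by (intro GDERIV_diff G) auto
        show "\<bar>w m y - w n y\<bar> \<le> 2 * \<eta>" using N[OF mn(1) yK] N[OF mn(2) yK] by linarith
        have xc: "x \<in> cball x t" using t by simp
        have "norm ((G m x - G n x) - (G m y - G n y)) \<le> norm (G m x - G m y) + norm (G n x - G n y)"
          using norm_triangle_ineq4[of "G m x - G m y" "G n x - G n y"] by (simp add: algebra_simps)
        also have "\<dots> \<le> L * norm (x - y) + L * norm (x - y)"
          by (intro add_mono L[OF convex_cball sub xc y])
        finally show "norm (G m x - G n x - (G m y - G n y)) \<le> 2 * L * norm (x - y)" by simp
      qed (use L0 in simp)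
      also have "\<dots> = (\<epsilon> - 2 * L * t) / 2 + 2 * L * t" using t by (simp add: \<eta>_def)
      also have "\<dots> < \<epsilon>" using tL by (simp add: field_simps)
      finally show "dist (G m x) (G n x) < \<epsilon>" by (simp add: dist_norm)
    qed
  qed
  define P where "P x = lim (\<lambda>n. G n x)" for x
  have unifG: "uniform_limit K G P sequentially" if "compact K" "K \<subseteq> S" for K
    using ucon[OF that] unfolding uniformly_convergent_uniform_limit_iff P_def .
  have loc: "GDERIV V a :> P a \<and> isCont P a" if a: "a \<in> S" for a
  proof -
    obtain r where r: "0 < r" "cball a r \<subseteq> S" using S a open_contains_cball by blast
    have "continuous_on (cball a r) P"
      by (rule uniform_limit_theorem[OF _ unifG[OF compact_cball r(2)]])
        (auto intro!: always_eventually continuous_on_subset[OF cG r(2)])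
    then have cont: "isCont P a" by (rule continuous_on_interior) (use r in simp)
    have "\<exists>W. \<forall>x\<in>cball a r. (\<lambda>n. w n x) \<longlonglongrightarrow> W x \<and> (W has_derivative (\<lambda>h. h \<bullet> P x)) (at x within cball a r)"
    proof (rule has_derivative_sequence[where f' = "\<lambda>n x h. h \<bullet> G n x"])
      show "(w n has_derivative (\<lambda>h. h \<bullet> G n x)) (at x within cball a r)" if "x \<in> cball a r" for n x
        using G[of x n] that r(2) unfolding gderiv_def by (blast intro: has_derivative_at_withinI)
      show "\<forall>\<^sub>F n in sequentially. \<forall>x\<in>cball a r. \<forall>h. norm (h \<bullet> G n x - h \<bullet> P x) \<le> e * norm h"
        if e: "0 < e" for e
        using uniform_limitD[OF unifG[OF compact_cball r(2)] e]
      proof eventually_elim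
        case (elim n)
        show ?case
        proof (intro ballI allI)
          fix x h assume x: "x \<in> cball a r"
          have "norm (h \<bullet> G n x - h \<bullet> P x) \<le> norm h * norm (G n x - P x)"
            using Cauchy_Schwarz_ineq2[of h "G n x - P x"] by (simp add: inner_diff_right)
          also have "\<dots> \<le> norm h * e" using elim x by (intro mult_left_mono) (auto simp: dist_norm less_imp_le)
          finally show "norm (h \<bullet> G n x - h \<bullet> P x) \<le> e * norm h" by (simp add: mult.commute)
        qed
      qed
      show "a \<in> cball a r" using r by simp
      show "(\<lambda>n. w n a) \<longlonglongrightarrow> V a" by (rule lim[OF a])
    qed (rule convex_cball)
    then obtain W where W: "\<And>x. x \<in> cball a r \<Longrightarrow> (\<lambda>n. w n x) \<longlonglongrightarrow> W x"
      "\<And>x. x \<in> cball a r \<Longrightarrow> (W has_derivative (\<lambda>h. h \<bullet> P x)) (at x within cball a r)" by blast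
    have WV: "W x = V x" if "x \<in> cball a r" for x
      using W(1)[OF that] lim[of x] that r(2) LIMSEQ_unique by blast
    have "(W has_derivative (\<lambda>h. h \<bullet> P a)) (at a within cball a r)" using W(2) r by simp
    then have "(V has_derivative (\<lambda>h. h \<bullet> P a)) (at a within cball a r)"
      by (rule has_derivative_transform[rotated -1]) (use WV r in auto)
    then show ?thesis using cont r at_within_interior[of a "cball a r"] by (simp add: gderiv_def)
  qed
  show ?thesis
    by (rule that[of P]) (use loc unif unifG in \<open>auto intro: continuous_at_imp_continuous_on\<close>)
qed

section \<open>Convergence to the optimal value function\<close>

lemma grad_Lipschitz_of_hessian:
  assumes C: "convex C" and d: "\<And>x. x \<in> C \<Longrightarrow> grad w differentiable (at x)"
    and L: "\<And>x. x \<in> C \<Longrightarrow> spectral_norm (hessian w x) \<le> L" and xy: "x \<in> C" "y \<in> C"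
  shows "norm (grad w x - grad w y) \<le> L * norm (x - y)"
proof (rule differentiable_bound[OF C _ _ xy])
  fix z assume z: "z \<in> C"
  show "(grad w has_derivative (*v) (hessian w z)) (at z within C)"
    using d[OF z] unfolding jacobian_works hessian_def by (rule has_derivative_at_withinI)
  show "onorm ((*v) (hessian w z)) \<le> L" using L[OF z] by (simp add: spectral_norm_def)
qed

lemma c0_norm_tendsto_0:
  assumes "uniform_limit K w W sequentially"
  shows "(\<lambda>s. c0_norm K (\<lambda>x. w s x - W x)) \<longlonglongrightarrow> 0"
proof (rule order_tendstoI)
  fix a :: ennreal assume "0 < a"
  \<comment> \<open>A positive rational below \<open>a\<close> gives a finite real tolerance even
    for \<open>a = \<infinity>\<close>, and leaves the strict gap that is lost in passing to the
    supremum.\<close>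
  then obtain q where q: "0 < ennreal (real_of_rat q)" "ennreal (real_of_rat q) < a"
    using ennreal_rat_dense by blast
  then have "0 < real_of_rat q" by (simp only: ennreal_less_zero_iff)
  from uniform_limitD[OF assms this]
  show "\<forall>\<^sub>F s in sequentially. c0_norm K (\<lambda>x. w s x - W x) < a"
  proof eventually_elim
    case (elim s)
    have "c0_norm K (\<lambda>x. w s x - W x) \<le> ennreal (real_of_rat q)"
      unfolding c0_norm_def
      by (rule SUP_least) (use elim in \<open>auto simp: dist_norm less_imp_le intro!: ennreal_leI\<close>)
    with q(2) show ?case by (rule le_less_trans[rotated])
  qed
qed simp

text \<open>The map is linear in \<open>p\<close>, with a norm bounded uniformly over
  \<open>x\<close> in \<open>K\<close>: compactness of \<open>K\<close> times the unit ball gives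
  the bound on unit vectors, and homogeneity extends it.\<close>

lemma uniform_limit_improved_input:
  fixes g :: "real^'n \<Rightarrow> real^'m^'n"
  assumes K: "compact K" and g: "continuous_on UNIV g" and p: "uniform_limit K p P sequentially"
  shows "uniform_limit K (\<lambda>s x. improved_input (g x) R (p s x)) (\<lambda>x. improved_input (g x) R (P x)) sequentially"
proof -
  let ?\<Phi> = "\<lambda>z::(real^'n) \<times> (real^'n). improved_input (g (fst z)) R (snd z)"
  have "continuous_on (K \<times> cball 0 1) ?\<Phi>"
    unfolding improved_input_def
    by (intro continuous_intros continuous_on_compose2[OF g]) auto
  then have "bounded (?\<Phi> ` (K \<times> cball 0 1))"
    by (intro compact_imp_bounded compact_continuous_image compact_Times K compact_cball)
  then obtain B where B: "0 < B" "\<And>x p. x \<in> K \<Longrightarrow> norm p \<le> 1 \<Longrightarrow> norm (improved_input (g x) R p) \<le> B"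
    unfolding bounded_pos by fastforce
  have scale: "improved_input A R (c *\<^sub>R q) = c *\<^sub>R improved_input A R q" for A :: "real^'m^'n" and c q
    by (simp add: improved_input_def matrix_vector_mult_scaleR scaleR_vector_matrix_assoc[symmetric]
        del: transpose_matrix_vector)
  have lin: "norm (improved_input (g x) R q) \<le> B * norm q" if "x \<in> K" for x q
  proof -
    have "improved_input (g x) R q = norm q *\<^sub>R improved_input (g x) R (sgn q)"
      unfolding scale[symmetric] by (cases "q = 0") (simp_all add: sgn_div_norm)
    then have "norm (improved_input (g x) R q) = norm q * norm (improved_input (g x) R (sgn q))" by simp
    also have "\<dots> \<le> norm q * B" using B(2)[OF that, of "sgn q"] by (intro mult_left_mono) (auto simp: norm_sgn)
    finally show ?thesis by (simp add: mult.commute)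
  qed
  have diff: "improved_input A R q - improved_input A R q' = improved_input A R (q - q')"
    for A :: "real^'m^'n" and q q'
    by (simp add: improved_input_def matrix_vector_mult_diff_distrib algebra_simps
        del: transpose_matrix_vector)
  show ?thesis
  proof (rule uniform_limitI)
    fix e :: real assume e: "0 < e"
    have "0 < e / B" using e B by simp
    from uniform_limitD[OF p this]
    show "\<forall>\<^sub>F s in sequentially. \<forall>x\<in>K. dist (improved_input (g x) R (p s x)) (improved_input (g x) R (P x)) < e"
    proof eventually_elim
      case (elim s)
      show ?case
      proof
        fix x assume x: "x \<in> K"
        have "dist (improved_input (g x) R (p s x)) (improved_input (g x) R (P x)) \<le> B * norm (p s x - P x)"
          unfolding dist_norm diff by (rule lin[OF x])
        also have "\<dots> < B * (e / B)" using elim x B by (intro mult_strict_left_mono) (auto simp: dist_norm)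
        finally show "dist (improved_input (g x) R (p s x)) (improved_input (g x) R (P x)) < e" using B by simp
      qed
    qed
  qed
qed

section \<open>Identification of the limit with the optimal value function\<close>

context policy_iteration_run
begin

lemma optimal_limit:
  fixes S :: "(real^'n) set" and us :: "real^'n \<Rightarrow> real^'m" and V :: "real^'n \<Rightarrow> real"
    and P :: "real^'n \<Rightarrow> real^'n"
  assumes sub: "S \<subseteq> (\<Inter>s. Om s)" and opt: "optimal_controller f g h R us S"
    and lim: "\<And>x. x \<in> S \<Longrightarrow> (\<lambda>s. v s x) \<longlonglongrightarrow> V x"
    and limG: "\<And>x. x \<in> S \<Longrightarrow> (\<lambda>s. grad (v s) x) \<longlonglongrightarrow> P x"
    and P: "\<And>x. x \<in> S \<Longrightarrow> GDERIV V x :> P x"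
    and x: "x \<in> S"
  shows "opt_value f g h R x = ereal (V x)" "us x = improved_input (g x) R (P x)"
proof -
  define U where "U y = improved_input (g y) R (P y)" for y
  have SO: "y \<in> Om s" "y \<in> dom s" if "y \<in> S" for y s
    using that sub Om_subset_dom by auto
  have V_le: "V y \<le> v 0 y" if y: "y \<in> S" for y
  proof (rule LIMSEQ_le_const2[OF lim[OF y]])
    have "decseq (\<lambda>s. v s y)" using v_Suc_le SO(1)[OF y] by (intro decseq_SucI) auto
    then show "\<exists>N. \<forall>n\<ge>N. v n y \<le> v 0 y" using decseqD by blast
  qed
  \<comment> \<open>The limit equation is first obtained at \<open>a = U y\<close>; completing the
    square then gives it for every input, with an explicit defect that vanishes only at
    \<open>U y\<close>.\<close>
  have hjb: "P y \<bullet> (f y + g y *v a) = - (h y + a \<bullet> (R *v a)) + (a - U y) \<bullet> (R *v (a - U y))"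
    if y: "y \<in> S" for y a
  proof -
    have Ulim: "(\<lambda>s. u (Suc s) y) \<longlonglongrightarrow> U y"
      using uniform_limit_improved_input[of "{y}" g "\<lambda>s. grad (v s)" P R] limG[OF y]
        u_Suc[OF SO(2)[OF y]] cont_g by (simp add: U_def uniform_limit_singleton)
    \<comment> \<open>The equation pairs \<open>u (Suc s)\<close> with the gradient of
      \<open>v (Suc s)\<close>, while \<open>u (Suc s)\<close> is built from that of
      \<open>v s\<close>. Both gradients tend to \<open>P y\<close>, so the mismatch
      disappears.\<close>
    have "(\<lambda>s. grad (v (Suc s)) y \<bullet> (f y + g y *v u (Suc s) y) + (h y + u (Suc s) y \<bullet> (R *v u (Suc s) y)))
        \<longlonglongrightarrow> P y \<bullet> (f y + g y *v U y) + (h y + U y \<bullet> (R *v U y))"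
      by (intro tendsto_intros LIMSEQ_Suc[OF limG[OF y]] Ulim
          bounded_linear.tendsto[OF matrix_vector_mul_bounded_linear])
    moreover have "grad (v (Suc s)) y \<bullet> (f y + g y *v u (Suc s) y) + (h y + u (Suc s) y \<bullet> (R *v u (Suc s) y)) = 0" for s
      using ghjb[OF SO(2)[OF y], of "Suc s"] by (simp add: closed_loop_def run_cost_def)
    ultimately have "P y \<bullet> (f y + g y *v U y) + (h y + U y \<bullet> (R *v U y)) = 0"
      by (simp add: LIMSEQ_const_iff)
    moreover have "P y \<bullet> (f y + g y *v U y) + U y \<bullet> (R *v U y) = P y \<bullet> f y - U y \<bullet> (R *v U y)"
      unfolding U_def by (subst hamiltonian_complete_square[OF pos_def_R]) simp
    moreover have "P y \<bullet> (f y + g y *v a) + a \<bullet> (R *v a)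
        = (P y \<bullet> f y - U y \<bullet> (R *v U y)) + (a - U y) \<bullet> (R *v (a - U y))"
      unfolding U_def by (rule hamiltonian_complete_square[OF pos_def_R])
    ultimately show ?thesis by linarith
  qed
  obtain \<phi> where \<phi>: "closed_loop_flow f g us S \<phi>"
    "\<And>y. y \<in> S \<Longrightarrow> cost h R (\<phi> y) (\<lambda>t. us (\<phi> y t)) = opt_value f g h R y"
    and cus: "continuous_on S us"
    using opt unfolding optimal_controller_def by blast
  define X where "X = \<phi> x"
  define F where "F y = f y + g y *v us y" for y
  define l where "l y = h y + us y \<bullet> (R *v us y)" for y
  define q where "q y = (us y - U y) \<bullet> (R *v (us y - U y))" for y
  have X0: "X 0 = x" and X: "trajectory_in S F X"
    using \<phi>(1) x by (auto simp: closed_loop_flow_def trajectory_in_def X_def F_def)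
  have PF: "P y \<bullet> F y = - l y + q y" if "y \<in> S" for y
    using hjb[OF that, of "us y"] by (simp add: F_def l_def q_def)
  have q0: "0 \<le> q y" for y unfolding q_def by (rule pos_def_matrix_nonneg[OF pos_def_R])
  have lh: "h y \<le> l y" for y using pos_def_matrix_nonneg[OF pos_def_R, of "us y"] by (simp add: l_def)
  have l0: "0 \<le> l y" for y using lh[of y] h_nonneg[of y] by linarith
  have "continuous_on S l" unfolding l_def by (intro continuous_intros cont_h cus)
  then have lX: "continuous_on {0..} (\<lambda>t. l (X t))"
    by (rule continuous_on_compose2[OF _ trajectory_in_continuous[OF X]]) (auto simp: trajectory_inD[OF X])
  obtain L where L: "L 0 = 0" "\<And>t. 0 \<le> t \<Longrightarrow> (L has_real_derivative l (X t)) (at t)"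
    using real_primitive_exists[OF lX] by blast
  let ?I = "\<integral>\<^sup>+t\<in>{0..}. ennreal (l (X t)) \<partial>lebesgue"
  have I: "opt_value f g h R x = enn2ereal ?I"
    using \<phi>(2)[OF x] by (simp add: cost_def X_def l_def)
  have le_v: "opt_value f g h R x \<le> ereal (v (Suc s) x)" for s
    by (rule opt_value_le_v[OF SO(1)[OF x]])
  have "?I < \<infinity>" using le_v[of 0] I by (cases ?I) auto
  then obtain c where c: "0 \<le> c" "?I = ennreal c" by (cases ?I) auto
  have opt_c: "opt_value f g h R x = ereal c" using I c by simp
  have c_le: "c \<le> V x"
    using le_v opt_c by (intro LIMSEQ_le_const[OF LIMSEQ_Suc[OF lim[OF x]]]) auto
  have L_le: "L T \<le> c" if T: "0 \<le> T" for T
    using nn_integral_primitive(1)[OF lX l0 L T] c by simp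
  text \<open>The running cost is integrable, so the optimal trajectory returns arbitrarily close to the
    origin.\<close>
  have small: "\<exists>T\<ge>1. V (X T) < e" if e: "0 < e" for e
  proof -
    have dom0: "open (dom 0)" "0 \<in> dom 0" using stabilizing[of 0] by (auto simp: stabilizing_def)
    \<comment> \<open>\<open>S\<close> need not contain 0, so continuity of \<open>V\<close> at the
      origin is not at hand; \<open>v 0\<close> is continuous there and dominates \<open>V\<close>
      on \<open>S\<close>.\<close>
    have "isCont (v 0) 0" using cont_v[of 0] dom0 continuous_on_eq_continuous_at by blast
    then obtain \<delta> where \<delta>: "0 < \<delta>" "\<And>y. norm y < \<delta> \<Longrightarrow> \<bar>v 0 y\<bar> < e"
      using e v_zero[of 0] unfolding continuous_at_eps_delta by (auto simp: dist_norm)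
    have "\<exists>T\<ge>1. norm (X T) < \<delta>"
    proof (rule ccontr)
      assume "\<not> (\<exists>T\<ge>1. norm (X T) < \<delta>)"
      then have far: "\<And>t. 1 \<le> t \<Longrightarrow> \<delta> \<le> norm (X t)" by force
      define A where "A = closure S - ball 0 \<delta>"
      have "bounded S" using bounded_dom[of 0] SO(2) by (meson bounded_subset subsetI)
      then have A: "compact A" unfolding A_def by (intro compact_diff) auto
      have XA: "X t \<in> A" if "1 \<le> t" for t
        using far[OF that] trajectory_inD(1)[OF X, of t] that closure_subset[of S] by (auto simp: A_def)
      obtain z where z: "z \<in> A" "\<And>y. y \<in> A \<Longrightarrow> h z \<le> h y"
        using continuous_attains_inf[OF A _ cont_h] XA[of 1] by auto
      have "z \<noteq> 0" using z(1) \<delta> by (auto simp: A_def)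
      then have hz: "0 < h z" by (rule h_pos)
      \<comment> \<open>Staying away from 0 after time 1 would cost at least \<open>h z\<close> per
        unit of time, so by this \<open>T\<close> the accumulated cost would reach
        \<open>c + 1\<close>, beyond its bound \<open>c\<close>.\<close>
      define T where "T = 1 + (c - L 1 + 1) / h z"
      have T: "1 \<le> T" using L_le[of 1] hz by (simp add: T_def)
      have "h z * T - L T \<le> h z * 1 - L 1"
      proof (rule real_derivative_nonpos_imp_le[OF T, of "\<lambda>t. h z * t - L t"])
        fix r :: real assume r: "1 \<le> r"
        show "((\<lambda>t. h z * t - L t) has_real_derivative h z - l (X r)) (at r within {1..})"
          using r by (auto intro!: derivative_eq_intros has_field_derivative_at_within[OF L(2)])
        show "h z - l (X r) \<le> 0" using z(2)[OF XA[OF r]] lh[of "X r"] by linarith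
      qed
      moreover have "h z * T = h z + (c - L 1 + 1)" using hz unfolding T_def distrib_left by simp
      ultimately have "c + 1 \<le> L T" by linarith
      with L_le[of T] T show False by linarith
    qed
    then obtain T where T: "1 \<le> T" "norm (X T) < \<delta>" by blast
    have "V (X T) < e"
      using V_le[OF trajectory_inD(1)[OF X, of T]] \<delta>(2)[OF T(2)] T by linarith
    then show ?thesis using T by blast
  qed
  have der: "((\<lambda>t. V (X t) + L t) has_real_derivative q (X r)) (at r within {0..})" if r: "0 \<le> r" for r
  proof -
    have "((\<lambda>t. V (X t) + L t) has_real_derivative P (X r) \<bullet> F (X r) + l (X r)) (at r within {0..})"
      by (intro DERIV_add has_real_derivative_along trajectory_inD[OF X r] P
          has_field_derivative_at_within[OF L(2)[OF r]])
    then show ?thesis using PF[OF trajectory_inD(1)[OF X r]] by simp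
  qed
  have mono: "V (X s) + L s \<le> V (X t) + L t" if st: "0 \<le> s" "s \<le> t" for s t
  proof -
    have "- (V (X t) + L t) \<le> - (V (X s) + L s)"
    proof (rule real_derivative_nonpos_imp_le[OF st(2), of "\<lambda>t. - (V (X t) + L t)" "\<lambda>t. - q (X t)"])
      fix r assume r: "s \<le> r"
      show "((\<lambda>t. - (V (X t) + L t)) has_real_derivative - q (X r)) (at r within {s..})"
        by (rule has_field_derivative_subset[OF DERIV_minus[OF der]]) (use r st in auto)
      show "- q (X r) \<le> 0" using q0 by simp
    qed
    then show ?thesis by simp
  qed
  \<comment> \<open>The bound is needed on a whole interval after time 0, not only at 0, to refute a
    strict initial increase below. The restriction \<open>s \<le> 1\<close> matches the return
    times, which are at least 1.\<close>
  have bound: "V (X s) + L s \<le> c" if s: "0 \<le> s" "s \<le> 1" for s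
  proof (rule field_le_epsilon)
    fix e :: real assume "0 < e"
    then obtain T where T: "1 \<le> T" "V (X T) < e" using small by blast
    then show "V (X s) + L s \<le> c + e" using mono[OF s(1), of T] L_le[of T] s by linarith
  qed
  have Vc: "V x = c" using bound[of 0] c_le X0 L(1) by simp
  then show "opt_value f g h R x = ereal (V x)" by (simp add: opt_c)
  \<comment> \<open>At time 0 the sum \<open>V (X t) + L t\<close> already equals its upper bound
    \<open>c\<close>, while \<open>q x\<close> is its derivative there.\<close>
  have "\<not> 0 < q x"
  proof
    assume "0 < q x"
    then have "\<exists>d>0. \<forall>r>0. 0 + r \<in> {0..} \<longrightarrow> r < d \<longrightarrow> V (X 0) + L 0 < V (X (0 + r)) + L (0 + r)"
      using has_real_derivative_pos_inc_right[OF der[of 0]] X0 by simp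
    then obtain d where d: "0 < d"
      "\<forall>r>0. 0 + r \<in> {0..} \<longrightarrow> r < d \<longrightarrow> V (X 0) + L 0 < V (X (0 + r)) + L (0 + r)" by blast
    define r where "r = min 1 (d / 2)"
    have r: "0 < r" "r < d" "r \<le> 1" using d(1) by (auto simp: r_def)
    have "V x < V (X r) + L r" using d(2)[rule_format, of r] r X0 L(1) by simp
    then show False using bound[of r] r Vc by simp
  qed
  then have "us x - U x = 0"
    using pos_def_R unfolding q_def pos_def_matrix_def by blast
  then show "us x = improved_input (g x) R (P x)" by (simp add: U_def)
qed

theorem convergence:
  assumes dS: "domain S" and sub: "S \<subseteq> (\<Inter>s. Om s)" and opt: "optimal_controller f g h R us S"
    and bnd: "\<And>K. compact K \<Longrightarrow> K \<subseteq> S \<Longrightarrow> \<exists>C1>0. \<forall>s. \<forall>x\<in>K. norm (grad (v s) x) \<le> C1"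
    and hes: "\<And>K. compact K \<Longrightarrow> K \<subseteq> S \<Longrightarrow> \<exists>C2>0. \<forall>s. \<forall>x\<in>K. grad (v s) differentiable (at x) \<and>
                                  spectral_norm (hessian (v s) x) \<le> C2"
  defines "vs \<equiv> \<lambda>x. real_of_ereal (opt_value f g h R x)"
  shows "x \<in> S \<Longrightarrow> \<bar>opt_value f g h R x\<bar> \<noteq> \<infinity>"
    and "Ck_on 1 S vs"
    and "compact K \<Longrightarrow> K \<subseteq> S \<Longrightarrow> (\<lambda>s. c1_norm K (\<lambda>x. v s x - vs x)) \<longlonglongrightarrow> 0"
    and "compact K \<Longrightarrow> K \<subseteq> S \<Longrightarrow> (\<lambda>s. c0_norm K (\<lambda>x. u s x - us x)) \<longlonglongrightarrow> 0"
proof -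
  have S: "open S" using dS by (simp add: domain_def)
  have SO: "y \<in> Om s" "y \<in> dom s" if "y \<in> S" for y s
    using that sub Om_subset_dom by auto
  define V where "V x = lim (\<lambda>s. v s x)" for x
  have lim: "(\<lambda>s. v s x) \<longlonglongrightarrow> V x" if x: "x \<in> S" for x
  proof -
    have "decseq (\<lambda>s. v s x)" using v_Suc_le SO(1)[OF x] by (intro decseq_SucI) auto
    then have "convergent (\<lambda>s. v s x)"
      using decseq_convergent[of "\<lambda>s. v s x" 0] v_nonneg[OF SO(2)[OF x]] by (metis convergentI)
    then show ?thesis by (simp add: V_def convergent_LIMSEQ_iff)
  qed
  obtain P where P: "\<And>x. x \<in> S \<Longrightarrow> GDERIV V x :> P x" "continuous_on S P"
    and ul: "\<And>K. compact K \<Longrightarrow> K \<subseteq> S \<Longrightarrow> uniform_limit K v V sequentially"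
    and ulG: "\<And>K. compact K \<Longrightarrow> K \<subseteq> S \<Longrightarrow> uniform_limit K (\<lambda>s. grad (v s)) P sequentially"
  proof (rule decreasing_C1_limit[OF S, of v "\<lambda>s. grad (v s)" V])
    show "GDERIV (v n) x :> grad (v n) x" if "x \<in> S" for n x by (rule gderiv_v[OF SO(2)[OF that]])
    show "continuous_on S (grad (v n))" for n
      by (rule continuous_on_subset[OF cont_grad_v]) (use SO in blast)
    show "v (Suc n) x \<le> v n x" if "x \<in> S" for n x by (rule v_Suc_le[OF SO(1)[OF that]])
    show "(\<lambda>n. v n x) \<longlonglongrightarrow> V x" if "x \<in> S" for x by (rule lim[OF that])
    show "\<exists>B. \<forall>n. \<forall>x\<in>K. norm (grad (v n) x) \<le> B" if "compact K" "K \<subseteq> S" for K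
      using bnd[OF that] by blast
    show "\<exists>L\<ge>0. \<forall>n C. convex C \<longrightarrow> C \<subseteq> K \<longrightarrow>
        (\<forall>x\<in>C. \<forall>y\<in>C. norm (grad (v n) x - grad (v n) y) \<le> L * norm (x - y))"
      if K: "compact K" "K \<subseteq> S" for K
    proof -
      from hes[OF K] obtain L where L: "L > 0" "\<forall>s. \<forall>x\<in>K. grad (v s) differentiable (at x) \<and>
          spectral_norm (hessian (v s) x) \<le> L" by (elim exE conjE)
      show ?thesis
      proof (intro exI[of _ L] conjI allI impI ballI)
        show "0 \<le> L" using L by simp
        fix n C x y assume C: "convex C" "C \<subseteq> K" "x \<in> C" "y \<in> C"
        show "norm (grad (v n) x - grad (v n) y) \<le> L * norm (x - y)"
          by (rule grad_Lipschitz_of_hessian[OF C(1) _ _ C(3,4)]) (use L(2) C(2) in blast)+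
      qed
    qed
  qed (rule that)
  have limG: "(\<lambda>s. grad (v s) x) \<longlonglongrightarrow> P x" if "x \<in> S" for x
    using ulG[of "{x}"] that by (simp add: uniform_limit_singleton)
  have ov: "opt_value f g h R x = ereal (V x)" "us x = improved_input (g x) R (P x)" if "x \<in> S" for x
    by (rule optimal_limit[OF sub opt lim limG P(1) that]; assumption)+
  have vsV: "vs x = V x" if "x \<in> S" for x using ov(1)[OF that] by (simp add: vs_def)
  have gvs: "GDERIV vs x :> P x" if x: "x \<in> S" for x
    using P(1)[OF x] unfolding gderiv_def
    by (rule has_derivative_transform_within_open[OF _ S x]) (simp add: vsV)
  show "\<bar>opt_value f g h R x\<bar> \<noteq> \<infinity>" if "x \<in> S" using ov(1)[OF that] by simp
  show "Ck_on 1 S vs" by (rule Ck_on_1I[OF gvs P(2)])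
  assume K: "compact K" "K \<subseteq> S"
  have KS: "x \<in> S" if "x \<in> K" for x using K that by blast
  have gd: "grad (\<lambda>x. v s x - vs x) x = grad (v s) x - P x" if "x \<in> K" for s x
    by (intro grad_eqI GDERIV_diff gderiv_v SO(2) gvs KS that)
  have "c1_norm K (\<lambda>x. v s x - vs x) = c0_norm K (\<lambda>x. v s x - V x) + c0_norm K (\<lambda>x. grad (v s) x - P x)" for s
    using KS by (simp add: c1_norm_def c0_norm_def gd vsV cong: SUP_cong)
  moreover have "(\<lambda>s. c0_norm K (\<lambda>x. v s x - V x) + c0_norm K (\<lambda>x. grad (v s) x - P x)) \<longlonglongrightarrow> 0 + 0"
    by (intro tendsto_add c0_norm_tendsto_0 ul ulG K)
  ultimately show "(\<lambda>s. c1_norm K (\<lambda>x. v s x - vs x)) \<longlonglongrightarrow> 0" by simp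
  \<comment> \<open>The gradient formula describes the controllers from index 1 on, so convergence
    is shown for the shifted sequence and then shifted back.\<close>
  have "uniform_limit K (\<lambda>s x. improved_input (g x) R (grad (v s) x)) (\<lambda>x. improved_input (g x) R (P x)) sequentially"
    by (rule uniform_limit_improved_input[OF K(1) cont_g ulG[OF K]])
  from c0_norm_tendsto_0[OF this]
  have "(\<lambda>s. c0_norm K (\<lambda>x. u (Suc s) x - us x)) \<longlonglongrightarrow> 0"
    using KS by (simp add: c0_norm_def u_Suc[OF SO(2)] ov(2) cong: SUP_cong)
  then show "(\<lambda>s. c0_norm K (\<lambda>x. u s x - us x)) \<longlonglongrightarrow> 0" by (rule LIMSEQ_imp_Suc)
qed

end

theorem theorem4p4:
  fixes f :: "real^'n \<Rightarrow> real^'n"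
    and g :: "real^'n \<Rightarrow> real^'m^'n"
    and h :: "real^'n \<Rightarrow> real"
    and R :: "real^'m^'m"
    and \<Omega> :: "(real^'n) set"
    and u0 :: "real^'n \<Rightarrow> real^'m"
    and v :: "nat \<Rightarrow> real^'n \<Rightarrow> real"
    and u :: "nat \<Rightarrow> real^'n \<Rightarrow> real^'m"
    and Om :: "nat \<Rightarrow> (real^'n) set"
  assumes "data_assumption f g h R"
    and "domain \<Omega>" and "bounded \<Omega>"
    and "admissible f g u0 \<Omega>" and "smooth_on \<Omega> u0"
    and "policy_iteration f g h R u0 \<Omega> v u Om"
  shows "(\<forall>s. \<forall>x\<in>Om s. opt_value f g h R x \<le> ereal (v (Suc s) x) \<and> v (Suc s) x \<le> v s x)
    \<and> (\<forall>\<Omega>s us.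
         domain \<Omega>s \<and> \<Omega>s \<subseteq> (\<Inter>s. Om s) \<and> optimal_controller f g h R us \<Omega>s \<and>
         (\<forall>K. compact K \<and> K \<subseteq> \<Omega>s \<longrightarrow>
            (\<exists>C1>0. \<forall>s. \<forall>x\<in>K. norm (grad (v s) x) \<le> C1) \<and>
            (\<exists>C2>0. \<forall>s. \<forall>x\<in>K. grad (v s) differentiable (at x) \<and>
                                  spectral_norm (hessian (v s) x) \<le> C2))
         \<longrightarrow>
         (\<forall>x\<in>\<Omega>s. \<bar>opt_value f g h R x\<bar> \<noteq> \<infinity>) \<and>
         Ck_on 1 \<Omega>s (\<lambda>x. real_of_ereal (opt_value f g h R x)) \<and>
         (\<forall>K. compact K \<and> K \<subseteq> \<Omega>s \<longrightarrow>
            (\<lambda>s. c1_norm K (\<lambda>x. v s x - real_of_ereal (opt_value f g h R x))) \<longlonglongrightarrow> 0) \<and>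
         (\<forall>K. compact K \<and> K \<subseteq> \<Omega>s \<longrightarrow>
            (\<lambda>s. c0_norm K (\<lambda>x. u s x - us x)) \<longlonglongrightarrow> 0))"
proof -
  interpret policy_iteration_run f g h R \<Omega> u0 v u Om
    by unfold_locales (fact assms)+
  show ?thesis
  proof (intro conjI allI impI ballI; (elim conjE)?)
    fix s x assume "x \<in> Om s"
    then show "opt_value f g h R x \<le> ereal (v (Suc s) x)" "v (Suc s) x \<le> v s x"
      by (rule opt_value_le_v, rule v_Suc_le)
  next
    fix S us
    assume a: "domain S" "S \<subseteq> (\<Inter>s. Om s)" "optimal_controller f g h R us S"
      and b: "\<forall>K. compact K \<and> K \<subseteq> S \<longrightarrow>
            (\<exists>C1>0. \<forall>s. \<forall>x\<in>K. norm (grad (v s) x) \<le> C1) \<and>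
            (\<exists>C2>0. \<forall>s. \<forall>x\<in>K. grad (v s) differentiable (at x) \<and>
                                  spectral_norm (hessian (v s) x) \<le> C2)"
    have b1: "\<exists>C1>0. \<forall>s. \<forall>x\<in>K. norm (grad (v s) x) \<le> C1" if "compact K" "K \<subseteq> S" for K
      using b that by blast
    have b2: "\<exists>C2>0. \<forall>s. \<forall>x\<in>K. grad (v s) differentiable (at x) \<and>
        spectral_norm (hessian (v s) x) \<le> C2" if "compact K" "K \<subseteq> S" for K
      using b that by blast
    show "\<bar>opt_value f g h R x\<bar> \<noteq> \<infinity>" if "x \<in> S" for x by (rule convergence(1)[OF a b1 b2 that])
    show "Ck_on 1 S (\<lambda>x. real_of_ereal (opt_value f g h R x))" by (rule convergence(2)[OF a b1 b2])
    fix K assume K: "compact K" "K \<subseteq> S"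
    show "(\<lambda>s. c1_norm K (\<lambda>x. v s x - real_of_ereal (opt_value f g h R x))) \<longlonglongrightarrow> 0"
      by (rule convergence(3)[OF a b1 b2 K])
    show "(\<lambda>s. c0_norm K (\<lambda>x. u s x - us x)) \<longlonglongrightarrow> 0" by (rule convergence(4)[OF a b1 b2 K])
  qed
qed

end
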